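(* Let $p\ge1$ be an integer and let $n\in\mathbf N_0$ satisfy $$n(z)=-\frac{s_0}{z}-\frac{s_1}{z^2}-\cdots-\frac{s_{2p}}{z^{2p+1}}+\mathrm o\!\left(\frac1{z^{2p+1}}\right),\qquad z=iy,\ y\to\pm\infty,$$ with $\det(s_{i+l})_{i,l=0}^{p}\neq0$. Let $\sigma$ be the finite positive measure on $\mathbb R$ with $n(z)=\int_{\mathbb R}\frac{d\sigma(t)}{t-z}$, let $A$ be multiplication by the independent variable in $\mathcal H=L^2(\sigma)$, and let $u(t)\equiv1$, so that $n(z)=((A-z)^{-1}u,u)$. Put $n_0=n$ and, for $j=1,\dots,p$, let $n_j=\widehat{n_{j-1}}$ be the Schur transform of $n_{j-1}$. For $j=1,\dots,p$ let $\mathcal H_j'=\mathcal H\ominus\operatorname{span}\{u,Au,\dots,A^{j-1}u\}$, let $P_{\mathcal H_j'}$ be the orthogonal projection in $\mathcal H$ onto $\mathcal H_j'$, and define $$A_j=P_{\mathcal H_j'}A|_{\mathcal H_j'},\qquad u_j=\frac{P_{\mathcal H_j'}A^ju}{\|u\|\,\|u_1\|\cdots\|u_{j-1}\|}$$ (where $A_j$ has domain $\operatorname{dom}A\cap\mathcal H_j'$, and for $j=1$ the denominator is $\|u\|$). Then for $j=1,\dots,p$ an operator representation of $n_j$ is given by $\mathcal H_j'$, $A_j$, $u_j$, that is, $A_j$ is self-adjoint in $\mathcal H_j'$ and $$n_j(z)=\big((A_j-z)^{-1}u_j,u_j\big),\qquad z\in\mathbb C\setminus\mathbb R.$$ Moreover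 $\|u\|=\sqrt{s_0}$ and $\|u_j\|=b_{j-1}$ for $j=1,\dots,p$, where $b_0,\dots,b_{p-1}>0$ are the off-diagonal coefficients in the recurrence relations of the orthonormal polynomials associated with $n$.
   Context: A Nevanlinna function is a function $n$ that is analytic in the open upper half plane $\mathbb C^+$ with $\operatorname{Im} n(z)\ge 0$ for $z\in\mathbb C^+$; it is always extended to the lower half plane by $n(z)=n(z^* )^*$, where $z^*$ denotes the complex conjugate. $\mathbf N_0$ denotes the set of all Nevanlinna functions. If $m\in\mathbf N_0$, $m\not\equiv0$, satisfies $m(z)=-\frac{\tau_0}{z}-\frac{\tau_1}{z^2}+\mathrm o(z^{-2})$ for $z=iy$, $y\to\pm\infty$, its Schur transform is $\widehat m(z)=-\frac{\tau_0}{m(z)}-z+\frac{\tau_1}{\tau_0}$; it again belongs to $\mathbf N_0$. Under the assumptions of the claim all the iterated Schur transforms $n_1,\dots,n_p$ are defined. Under the assumptions of the claim the measure $\sigma$ has moments $s_i=\int t^i\,d\sigma(t)$, $0\le i\le2p$, so $A^ju=t^j\in L^2(\sigma)$ for $j\le p$. The orthonormal polynomials $e_0,\dots,e_p$ are obtained by Gram–Schmidt orthonormalization of $1,t,\dots,t^p$ in $L^2(\sigma)$ with positive leading coefficients; they satisfy $te_k=b_{k-1}e_{k-1}+a_ke_k+b_ke_{k+1}$, $0\le k\le p-1$, with $b_{-1}=0$, $a_k\in\mathbb R$, $b_k>0$. *)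

theory Defs
  imports
    "HOL-Analysis.Analysis"
    "HOL-Computational_Algebra.Polynomial"
    "HOL-Library.Landau_Symbols"
    "Jordan_Normal_Form.Determinant"
begin

section \<open>Nevanlinna functions, asymptotic expansions, Schur transform\<close>

text \<open>Values on the real line are irrelevant and left unconstrained.\<close>

definition nevanlinna :: "(complex \<Rightarrow> complex) set" where
  "nevanlinna = {m. m analytic_on {z. Im z > 0}
      \<and> (\<forall>z. Im z > 0 \<longrightarrow> Im (m z) \<ge> 0)
      \<and> (\<forall>z. Im z < 0 \<longrightarrow> m z = cnj (m (cnj z)))}"

text \<open>For a real variable \<open>y\<close> the filter \<^const>\<open>at_infinity\<close> covers both \<open>y \<rightarrow> \<infinity>\<close> and \<open>y \<rightarrow> -\<infinity>\<close>.\<close>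

definition nev_expansion :: "(complex \<Rightarrow> complex) \<Rightarrow> (nat \<Rightarrow> real) \<Rightarrow> nat \<Rightarrow> bool" where
  "nev_expansion m s N \<longleftrightarrow>
     (\<lambda>y::real. m (\<i> * of_real y) - (- (\<Sum>i\<le>N. of_real (s i) / (\<i> * of_real y) ^ (i + 1))))
       \<in> o[at_infinity](\<lambda>y. 1 / (\<i> * of_real y) ^ (N + 1))"

definition has_schur_transform :: "(complex \<Rightarrow> complex) \<Rightarrow> bool" where
  "has_schur_transform m \<longleftrightarrow>
     m \<in> nevanlinna \<and> (\<exists>z. z \<notin> \<real> \<and> m z \<noteq> 0) \<and> (\<exists>\<tau>. nev_expansion m \<tau> 1)"

text \<open>Only \<open>\<tau> 0\<close> and \<open>\<tau> 1\<close> are used, and these two values are uniquely determined by \<open>m\<close>.\<close>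

definition schur_transform :: "(complex \<Rightarrow> complex) \<Rightarrow> complex \<Rightarrow> complex" where
  "schur_transform m = (let \<tau> = (SOME \<tau>. nev_expansion m \<tau> 1) in
     (\<lambda>z. - of_real (\<tau> 0) / m z - z + of_real (\<tau> 1) / of_real (\<tau> 0)))"


section \<open>The Hilbert space of square-integrable functions\<close>

text \<open>
  Elements of \<open>L\<^sup>2(M)\<close> are represented by functions, and equality in \<open>L\<^sup>2(M)\<close> is equality
  almost everywhere.  The closed subspaces and the operator domains below contain with each
  function all measurable functions equal to it almost everywhere.  The inner product is linear in its first argument.
\<close>

definition L2 :: "real measure \<Rightarrow> (real \<Rightarrow> complex) set" where
  "L2 M = {f \<in> borel_measurable M. integrable M (\<lambda>t. (cmod (f t))\<^sup>2)}"

definition L2_inner :: "real measure \<Rightarrow> (real \<Rightarrow> complex) \<Rightarrow> (real \<Rightarrow> complex) \<Rightarrow> complex" where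
  "L2_inner M f g = (LINT t|M. f t * cnj (g t))"

definition L2_norm :: "real measure \<Rightarrow> (real \<Rightarrow> complex) \<Rightarrow> real" where
  "L2_norm M f = sqrt (LINT t|M. (cmod (f t))\<^sup>2)"

definition complex_span :: "(real \<Rightarrow> complex) set \<Rightarrow> (real \<Rightarrow> complex) set" where
  "complex_span F = {(\<lambda>t. \<Sum>f\<in>S. c f * f t) | S c. finite S \<and> S \<subseteq> F}"

definition L2_ominus :: "real measure \<Rightarrow> (real \<Rightarrow> complex) set \<Rightarrow> (real \<Rightarrow> complex) set" where
  "L2_ominus M S = {f \<in> L2 M. \<forall>g\<in>S. L2_inner M f g = 0}"

text \<open>The projection is determined up to equality almost everywhere.\<close>

definition L2_proj ::
  "real measure \<Rightarrow> (real \<Rightarrow> complex) set \<Rightarrow> (real \<Rightarrow> complex) \<Rightarrow> real \<Rightarrow> complex" where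
  "L2_proj M K f = (SOME g. g \<in> K \<and> (\<forall>h\<in>K. L2_inner M (\<lambda>t. f t - g t) h = 0))"


section \<open>Unbounded operators\<close>

text \<open>
  An operator in a closed subspace \<open>K\<close> is given by its domain \<open>D \<subseteq> K\<close> and its action \<open>T\<close> on
  \<open>D\<close>; values of \<open>T\<close> outside \<open>D\<close> are ignored.
\<close>

definition L2_dense :: "real measure \<Rightarrow> (real \<Rightarrow> complex) set \<Rightarrow> (real \<Rightarrow> complex) set \<Rightarrow> bool" where
  "L2_dense M K D \<longleftrightarrow> (\<forall>f\<in>K. \<forall>\<epsilon>>0. \<exists>g\<in>D. L2_norm M (\<lambda>t. f t - g t) < \<epsilon>)"

definition op_graph ::
  "real measure \<Rightarrow> (real \<Rightarrow> complex) set \<Rightarrow> (real \<Rightarrow> complex) set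
     \<Rightarrow> ((real \<Rightarrow> complex) \<Rightarrow> real \<Rightarrow> complex)
     \<Rightarrow> ((real \<Rightarrow> complex) \<times> (real \<Rightarrow> complex)) set" where
  "op_graph M K D T = {(g, h). g \<in> D \<and> h \<in> K \<and> (AE t in M. h t = T g t)}"

definition adjoint_graph ::
  "real measure \<Rightarrow> (real \<Rightarrow> complex) set \<Rightarrow> (real \<Rightarrow> complex) set
     \<Rightarrow> ((real \<Rightarrow> complex) \<Rightarrow> real \<Rightarrow> complex)
     \<Rightarrow> ((real \<Rightarrow> complex) \<times> (real \<Rightarrow> complex)) set" where
  "adjoint_graph M K D T =
     {(g, h). g \<in> K \<and> h \<in> K \<and> (\<forall>f\<in>D. L2_inner M (T f) g = L2_inner M f h)}"

definition self_adjoint_in ::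
  "real measure \<Rightarrow> (real \<Rightarrow> complex) set \<Rightarrow> (real \<Rightarrow> complex) set
     \<Rightarrow> ((real \<Rightarrow> complex) \<Rightarrow> real \<Rightarrow> complex) \<Rightarrow> bool" where
  "self_adjoint_in M K D T \<longleftrightarrow>
     D \<subseteq> K \<and> T ` D \<subseteq> K \<and> L2_dense M K D \<and> adjoint_graph M K D T = op_graph M K D T"

text \<open>The norm estimate gives both injectivity of \<open>T - z\<close> and boundedness of its inverse.\<close>

definition in_resolvent_set ::
  "real measure \<Rightarrow> (real \<Rightarrow> complex) set \<Rightarrow> (real \<Rightarrow> complex) set
     \<Rightarrow> ((real \<Rightarrow> complex) \<Rightarrow> real \<Rightarrow> complex) \<Rightarrow> complex \<Rightarrow> bool" where
  "in_resolvent_set M K D T z \<longleftrightarrow>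
     (\<forall>v\<in>K. \<exists>f\<in>D. AE t in M. T f t - z * f t = v t) \<and>
     (\<exists>C. \<forall>f\<in>D. L2_norm M f \<le> C * L2_norm M (\<lambda>t. T f t - z * f t))"

definition resolvent ::
  "real measure \<Rightarrow> (real \<Rightarrow> complex) set \<Rightarrow> ((real \<Rightarrow> complex) \<Rightarrow> real \<Rightarrow> complex)
     \<Rightarrow> complex \<Rightarrow> (real \<Rightarrow> complex) \<Rightarrow> real \<Rightarrow> complex" where
  "resolvent M D T z v = (SOME f. f \<in> D \<and> (AE t in M. T f t - z * f t = v t))"

definition operator_representation ::
  "real measure \<Rightarrow> (complex \<Rightarrow> complex) \<Rightarrow> (real \<Rightarrow> complex) set \<Rightarrow> (real \<Rightarrow> complex) set
     \<Rightarrow> ((real \<Rightarrow> complex) \<Rightarrow> real \<Rightarrow> complex) \<Rightarrow> (real \<Rightarrow> complex) \<Rightarrow> bool" where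
  "operator_representation M m K D T v \<longleftrightarrow>
     self_adjoint_in M K D T \<and> v \<in> K \<and>
     (\<forall>z. z \<notin> \<real> \<longrightarrow>
        in_resolvent_set M K D T z \<and> m z = L2_inner M (resolvent M D T z v) v)"


section \<open>Multiplication by the independent variable and its compressions\<close>

definition mult_dom :: "real measure \<Rightarrow> (real \<Rightarrow> complex) set" where
  "mult_dom M = {f \<in> L2 M. (\<lambda>t. of_real t * f t) \<in> L2 M}"

definition mult_op :: "(real \<Rightarrow> complex) \<Rightarrow> real \<Rightarrow> complex" where
  "mult_op f = (\<lambda>t. of_real t * f t)"

definition u_gen :: "real \<Rightarrow> complex" where
  "u_gen = (\<lambda>t. 1)"

definition H_sub :: "real measure \<Rightarrow> nat \<Rightarrow> (real \<Rightarrow> complex) set" where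
  "H_sub M j = L2_ominus M (complex_span {(mult_op ^^ i) u_gen | i. i < j})"

definition A_dom :: "real measure \<Rightarrow> nat \<Rightarrow> (real \<Rightarrow> complex) set" where
  "A_dom M j = mult_dom M \<inter> H_sub M j"

definition A_op :: "real measure \<Rightarrow> nat \<Rightarrow> (real \<Rightarrow> complex) \<Rightarrow> real \<Rightarrow> complex" where
  "A_op M j f = L2_proj M (H_sub M j) (mult_op f)"

fun u_seq :: "real measure \<Rightarrow> nat \<Rightarrow> real \<Rightarrow> complex" where
  "u_seq M 0 = u_gen"
| "u_seq M (Suc j) =
     (\<lambda>t. L2_proj M (H_sub M (Suc j)) ((mult_op ^^ Suc j) u_gen) t
            / of_real (\<Prod>i\<in>{..j}. L2_norm M (u_seq M i)))"


section \<open>Orthonormal polynomials\<close>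

text \<open>
  Gram--Schmidt applied to \<open>1, t, t\<^sup>2, \<dots>\<close>; dividing by the positive norm makes the leading
  coefficients positive.
\<close>

fun orthonormal_poly :: "real measure \<Rightarrow> nat \<Rightarrow> real poly" where
  "orthonormal_poly M k =
     (let q = Polynomial.monom 1 k
                - (\<Sum>i\<in>{..<k}. Polynomial.smult (LINT t|M. poly (Polynomial.monom 1 k) t * poly (orthonormal_poly M i) t)
                                 (orthonormal_poly M i))
      in Polynomial.smult (1 / sqrt (LINT t|M. (poly q t)\<^sup>2)) q)"

declare orthonormal_poly.simps [simp del]

definition three_term_recurrence ::
  "(nat \<Rightarrow> real poly) \<Rightarrow> (nat \<Rightarrow> real) \<Rightarrow> (nat \<Rightarrow> real) \<Rightarrow> nat \<Rightarrow> bool" where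
  "three_term_recurrence e a b k \<longleftrightarrow>
     [:0, 1:] * e k = (if k = 0 then 0 else Polynomial.smult (b (k - 1)) (e (k - 1)))
                        + Polynomial.smult (a k) (e k) + Polynomial.smult (b k) (e (k + 1))"

end

theory Submission
  imports Defs
begin

text \<open>
  Comparing real and imaginary parts of the expansion along the imaginary axis shows that \<open>\<sigma>\<close> has
  moments \<open>s\<^sub>0, \<dots>, s\<^sub>2\<^sub>p\<close> (Hamburger), and the determinant condition makes \<open>1, t, \<dots>, t\<^sup>p\<close>
  linearly independent in \<open>L\<^sup>2(\<sigma>)\<close>.  With orthonormal polynomials \<open>e\<^sub>j\<close> one has
  \<open>u\<^sub>j = b\<^sub>j\<^sub>-\<^sub>1 e\<^sub>j\<close>, and the functions \<open>m\<^sub>j(z) = ((A\<^sub>j - z)\<inverse> e\<^sub>j, e\<^sub>j)\<close> satisfy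
  \<open>b\<^sub>j\<^sup>2 m\<^sub>j\<^sub>+\<^sub>1(z) = a\<^sub>j - z - 1 / m\<^sub>j(z)\<close>.  Since
  \<open>m\<^sub>j(z) = - 1 / z - a\<^sub>j / z\<^sup>2 + o(z\<^sup>-\<^sup>2)\<close>, this is the Schur transform of \<open>b\<^sub>j\<^sub>-\<^sub>1\<^sup>2 m\<^sub>j\<close>.
  The resolvent of \<open>A\<^sub>j\<^sub>+\<^sub>1\<close> is a rank-one correction of that of \<open>A\<^sub>j\<close>, so resolvents exist by
  induction from multiplication by \<open>1 / (t - z)\<close>, and self-adjointness follows from solvability at
  \<open>z = \<plusminus>\<i>\<close>.
\<close>

section \<open>Calculus in the space of square-integrable functions\<close>

text \<open>The obstacle is that \<open>L2_proj\<close> and \<open>resolvent\<close> are picked by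
  \<open>SOME\<close>, so they are known only up to null sets, and that A_j hides a projection. The
  weak equation (tf, h) = z (f, h) + (v, h) for all h in \<open>H_sub M j\<close> avoids both: under
  the test functions the projection disappears, and passing from j to j + 1 merely shrinks the set
  of tests. Statements about the operators themselves are recovered through
  \<open>weak_sol_iff\<close> and \<open>L2_inner_A_op\<close>.

  The top index shapes the bounds: e_p lies in the space, but t e_p need not. So A_p still has
  resolvents, whereas a_p and the expansion of m_p are out of reach. This is the reason for the
  constant distinction between j \<le> p and j < p.

  The Schur transform does not change when m is multiplied by a positive constant, since tau_0 and
  tau_1 scale along with it. The factor b_(j-1)^2 in n_j therefore drops out at the next step, and
  the recursion can be set up for the unit vectors e_j.\<close>

lemma L2_D:
  assumes "f \<in> L2 M"
  shows "f \<in> borel_measurable M" "integrable M (\<lambda>t. (cmod (f t))\<^sup>2)"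
  using assms by (auto simp: L2_def)

lemma L2_inner_integrable:
  assumes "f \<in> L2 M" "g \<in> L2 M"
  shows "integrable M (\<lambda>t. f t * cnj (g t))"
proof (rule Bochner_Integration.integrable_bound)
  show "integrable M (\<lambda>t. (cmod (f t))\<^sup>2 + (cmod (g t))\<^sup>2)"
    using assms by (auto simp: L2_def)
  show "(\<lambda>t. f t * cnj (g t)) \<in> borel_measurable M"
    by (rule borel_measurable_times[OF L2_D(1)[OF assms(1)]
          measurable_compose[OF L2_D(1)[OF assms(2)] borel_measurable_continuous_onI]])
       (rule continuous_on_cnj[OF continuous_on_id])
  have "cmod (f t * cnj (g t)) \<le> norm ((cmod (f t))\<^sup>2 + (cmod (g t))\<^sup>2)" for t
    using sum_squares_bound[of "cmod (f t)" "cmod (g t)"]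
      mult_nonneg_nonneg[OF norm_ge_zero[of "f t"] norm_ge_zero[of "g t"]]
    unfolding norm_mult complex_mod_cnj real_norm_def by linarith
  then show "AE t in M. cmod (f t * cnj (g t)) \<le> norm ((cmod (f t))\<^sup>2 + (cmod (g t))\<^sup>2)"
    by simp
qed

lemma L2_zero: "(\<lambda>t. 0) \<in> L2 M"
  by (simp add: L2_def)

lemma L2_scale:
  assumes "f \<in> L2 M"
  shows "(\<lambda>t. c * f t) \<in> L2 M"
  using assms L2_D(1)[OF assms] by (auto simp: L2_def norm_mult power_mult_distrib)

lemma L2_add:
  assumes "f \<in> L2 M" "g \<in> L2 M"
  shows "(\<lambda>t. f t + g t) \<in> L2 M"
proof -
  have m: "(\<lambda>t. f t + g t) \<in> borel_measurable M"
    using assms by (auto simp: L2_def)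
  have "integrable M (\<lambda>t. (cmod (f t + g t))\<^sup>2)"
  proof (rule Bochner_Integration.integrable_bound)
    show "integrable M (\<lambda>t. 2 * (cmod (f t))\<^sup>2 + 2 * (cmod (g t))\<^sup>2)"
      using assms by (auto simp: L2_def)
    show "(\<lambda>t. (cmod (f t + g t))\<^sup>2) \<in> borel_measurable M"
      using m by measurable
    have "(cmod (f t + g t))\<^sup>2 \<le> 2 * (cmod (f t))\<^sup>2 + 2 * (cmod (g t))\<^sup>2" for t
    proof -
      have "(cmod (f t + g t))\<^sup>2 \<le> (cmod (f t) + cmod (g t))\<^sup>2"
        by (intro power_mono norm_triangle_ineq) auto
      then show ?thesis
        using sum_squares_bound[of "cmod (f t)" "cmod (g t)"] by (simp add: power2_sum)
    qed
    then show "AE t in M. norm ((cmod (f t + g t))\<^sup>2) \<le> norm (2 * (cmod (f t))\<^sup>2 + 2 * (cmod (g t))\<^sup>2)"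
      by (auto intro!: AE_I2)
  qed
  then show ?thesis using m by (simp add: L2_def)
qed

lemma L2_diff:
  assumes "f \<in> L2 M" "g \<in> L2 M"
  shows "(\<lambda>t. f t - g t) \<in> L2 M"
  using L2_add[OF assms(1) L2_scale[OF assms(2), of "-1"]] by simp

lemma L2_sum:
  assumes "\<And>i. i \<in> I \<Longrightarrow> f i \<in> L2 M"
  shows "(\<lambda>t. \<Sum>i\<in>I. f i t) \<in> L2 M"
  using assms
  by (induction I rule: infinite_finite_induct) (auto simp: L2_zero intro: L2_add)

lemma L2_inner_add:
  assumes "f \<in> L2 M" "g \<in> L2 M" "h \<in> L2 M"
  shows "L2_inner M (\<lambda>t. f t + g t) h = L2_inner M f h + L2_inner M g h"
  using assms by (simp add: L2_inner_def distrib_right L2_inner_integrable)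

lemma L2_inner_diff:
  assumes "f \<in> L2 M" "g \<in> L2 M" "h \<in> L2 M"
  shows "L2_inner M (\<lambda>t. f t - g t) h = L2_inner M f h - L2_inner M g h"
  using assms by (simp add: L2_inner_def left_diff_distrib L2_inner_integrable)

lemma L2_inner_scale: "L2_inner M (\<lambda>t. c * f t) h = c * L2_inner M f h"
  by (simp add: L2_inner_def mult.assoc)

lemma L2_inner_zero: "L2_inner M (\<lambda>t. 0) h = 0"
  by (simp add: L2_inner_def)

lemma L2_inner_sum:
  assumes "\<And>i. i \<in> I \<Longrightarrow> f i \<in> L2 M" "h \<in> L2 M"
  shows "L2_inner M (\<lambda>t. \<Sum>i\<in>I. f i t) h = (\<Sum>i\<in>I. L2_inner M (f i) h)"
  using assms
  by (induction I rule: infinite_finite_induct) (auto simp: L2_inner_zero L2_inner_add L2_sum)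

lemma L2_inner_cnj: "L2_inner M g f = cnj (L2_inner M f g)"
proof -
  have "cnj (L2_inner M f g) = (LINT t|M. cnj (f t * cnj (g t)))"
    unfolding L2_inner_def by (rule Bochner_Integration.integral_cnj[symmetric])
  then show ?thesis by (simp add: L2_inner_def mult.commute)
qed

lemma L2_inner_diff_right:
  assumes "f \<in> L2 M" "g \<in> L2 M" "h \<in> L2 M"
  shows "L2_inner M h (\<lambda>t. f t - g t) = L2_inner M h f - L2_inner M h g"
  using L2_inner_diff[OF assms] by (simp add: L2_inner_cnj[of M h])

lemma L2_inner_scale_right: "L2_inner M h (\<lambda>t. c * f t) = cnj c * L2_inner M h f"
  by (simp add: L2_inner_cnj[of M h] L2_inner_scale)

lemma L2_inner_sum_right:
  assumes "\<And>i. i \<in> I \<Longrightarrow> f i \<in> L2 M" "h \<in> L2 M"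
  shows "L2_inner M h (\<lambda>t. \<Sum>i\<in>I. f i t) = (\<Sum>i\<in>I. L2_inner M h (f i))"
  using arg_cong[OF L2_inner_sum[of I f M h, OF assms], of cnj]
  by (simp add: L2_inner_cnj[of M h])

lemma L2_inner_mult_op: "L2_inner M (mult_op f) g = L2_inner M f (mult_op g)"
  by (simp add: L2_inner_def mult_op_def ac_simps)

lemma L2_inner_mult_op_cnj: "L2_inner M (mult_op f) g = cnj (L2_inner M (mult_op g) f)"
  by (subst L2_inner_mult_op) (rule L2_inner_cnj)

lemma L2_inner_cong_AE:
  assumes "f \<in> L2 M" "f' \<in> L2 M" "h \<in> L2 M" "AE t in M. f t = f' t"
  shows "L2_inner M f h = L2_inner M f' h"
  unfolding L2_inner_def
  using L2_inner_integrable[OF assms(1,3)] L2_inner_integrable[OF assms(2,3)] assms(4)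
  by (intro integral_cong_AE) auto

lemma L2_norm_nonneg: "L2_norm M f \<ge> 0"
  by (simp add: L2_norm_def)

lemma L2_norm_power2: "(L2_norm M f)\<^sup>2 = (LINT t|M. (cmod (f t))\<^sup>2)"
  by (simp add: L2_norm_def)

lemma L2_inner_self: "L2_inner M f f = of_real ((L2_norm M f)\<^sup>2)"
  unfolding L2_norm_power2 L2_inner_def
  by (simp add: complex_norm_square[symmetric] flip: of_real_power)

lemma L2_norm_scale: "L2_norm M (\<lambda>t. c * f t) = cmod c * L2_norm M f"
  by (simp add: L2_norm_def norm_mult power_mult_distrib real_sqrt_mult)

lemma L2_norm_cong_AE:
  assumes "f \<in> borel_measurable M" "g \<in> borel_measurable M" "AE t in M. f t = g t"
  shows "L2_norm M f = L2_norm M g"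
  unfolding L2_norm_def using assms by (auto intro!: arg_cong[where f=sqrt] integral_cong_AE)

lemma L2_norm_eq_0_AE:
  assumes "f \<in> L2 M" "L2_norm M f = 0"
  shows "AE t in M. f t = 0"
proof -
  have "(LINT t|M. (cmod (f t))\<^sup>2) = 0"
    using assms(2) by (simp flip: L2_norm_power2)
  then show ?thesis
    using integral_nonneg_eq_0_iff_AE[OF L2_D(2)[OF assms(1)]] by auto
qed

text \<open>Pointwise 2ab \<le> a^2 + b^2 with both factors rescaled by sqrt \<epsilon>. It takes
  the place of Cauchy-Schwarz; the parameter is kept free so that \<epsilon> = |Im z| can later
  absorb a term |Im z| ||f||^2.\<close>

lemma L2_inner_Young:
  assumes "f \<in> L2 M" "g \<in> L2 M" "0 < \<epsilon>"
  shows "2 * cmod (L2_inner M f g) \<le> \<epsilon> * (L2_norm M f)\<^sup>2 + (L2_norm M g)\<^sup>2 / \<epsilon>"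
proof -
  have "2 * cmod (L2_inner M f g) \<le> 2 * (LINT t|M. cmod (f t * cnj (g t)))"
    unfolding L2_inner_def by (simp add: integral_norm_bound)
  also have "\<dots> = (LINT t|M. 2 * cmod (f t * cnj (g t)))" by simp
  also have "\<dots> \<le> (LINT t|M. \<epsilon> * (cmod (f t))\<^sup>2 + (cmod (g t))\<^sup>2 / \<epsilon>)"
  proof (rule integral_mono)
    show "integrable M (\<lambda>t. 2 * cmod (f t * cnj (g t)))"
      using L2_inner_integrable[OF assms(1,2)] integrable_norm by (intro integrable_mult_right)
    show "integrable M (\<lambda>t. \<epsilon> * (cmod (f t))\<^sup>2 + (cmod (g t))\<^sup>2 / \<epsilon>)"
      using L2_D[OF assms(1)] L2_D[OF assms(2)] by auto
    fix t
    have "2 * (sqrt \<epsilon> * cmod (f t)) * (cmod (g t) / sqrt \<epsilon>) \<le> (sqrt \<epsilon> * cmod (f t))\<^sup>2 + (cmod (g t) / sqrt \<epsilon>)\<^sup>2"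
      by (rule sum_squares_bound)
    then show "2 * cmod (f t * cnj (g t)) \<le> \<epsilon> * (cmod (f t))\<^sup>2 + (cmod (g t))\<^sup>2 / \<epsilon>"
      using assms(3) by (simp add: norm_mult power_mult_distrib power_divide)
  qed
  also have "\<dots> = \<epsilon> * (L2_norm M f)\<^sup>2 + (L2_norm M g)\<^sup>2 / \<epsilon>"
    using L2_D[OF assms(1)] L2_D[OF assms(2)] by (simp add: L2_norm_power2)
  finally show ?thesis .
qed

lemma L2_cong_AE:
  assumes "f \<in> L2 M" "g \<in> borel_measurable M" "AE t in M. f t = g t"
  shows "g \<in> L2 M"
proof -
  have "integrable M (\<lambda>t. (cmod (g t))\<^sup>2)"
    by (rule integrable_cong_AE_imp[OF L2_D(2)[OF assms(1)]]) (use assms in \<open>auto elim: eventually_mono\<close>)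
  then show ?thesis using assms by (simp add: L2_def)
qed

section \<open>Expansions along the imaginary axis\<close>

lemma nev_expansion_tendsto:
  assumes "nev_expansion m s N"
  shows "((\<lambda>y. (m (\<i> * of_real y) + (\<Sum>i\<le>N. of_real (s i) / (\<i> * of_real y) ^ (i + 1)))
           * (\<i> * of_real y) ^ (N + 1)) \<longlongrightarrow> 0) at_infinity"
  using smalloD_tendsto[OF assms[unfolded nev_expansion_def]] by simp

lemma nev_expansionI:
  assumes "((\<lambda>y. (m (\<i> * of_real y) + (\<Sum>i\<le>N. of_real (s i) / (\<i> * of_real y) ^ (i + 1)))
           * (\<i> * of_real y) ^ (N + 1)) \<longlongrightarrow> 0) at_infinity"
  shows "nev_expansion m s N"
  unfolding nev_expansion_def
proof (rule smalloI_tendsto)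
  show "((\<lambda>y. (m (\<i> * of_real y) - (- (\<Sum>i\<le>N. of_real (s i) / (\<i> * of_real y) ^ (i + 1)))) /
          (1 / (\<i> * of_real y) ^ (N + 1))) \<longlongrightarrow> 0) at_infinity"
    using assms by simp
  have "eventually (\<lambda>y::real. y \<noteq> 0) at_infinity"
    by (auto simp: eventually_at_infinity intro!: exI[of _ 1])
  then show "eventually (\<lambda>y::real. 1 / (\<i> * of_real y) ^ (N + 1) \<noteq> (0::complex)) at_infinity"
    by eventually_elim simp
qed

lemma tendsto_inverse_imaginary_axis:
  "((\<lambda>y::real. inverse (\<i> * of_real y :: complex)) \<longlongrightarrow> 0) at_infinity"
proof -
  have "((\<lambda>y::real. of_real (inverse y) :: complex) \<longlongrightarrow> of_real 0) at_infinity"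
    by (intro tendsto_of_real tendsto_inverse_0)
  from tendsto_mult[OF tendsto_const[of "-\<i>"] this] show ?thesis by simp
qed

text \<open>If R_N is the remainder multiplied by z^(N+1), then R_(N+1) = z R_N + s_(N+1); since
  R_(N+1) - s_(N+1) converges, dividing it by z gives 0 in the limit.\<close>

lemma nev_expansion_Suc:
  assumes "nev_expansion m s (Suc N)"
  shows "nev_expansion m s N"
proof (rule nev_expansionI)
  let ?z = "\<lambda>y::real. \<i> * of_real y :: complex"
  let ?r = "\<lambda>N y. (m (?z y) + (\<Sum>i\<le>N. of_real (s i) / ?z y ^ (i + 1))) * ?z y ^ (N + 1)"
  have "((\<lambda>y. (?r (Suc N) y - of_real (s (Suc N))) * inverse (?z y)) \<longlongrightarrow> (0 - of_real (s (Suc N))) * 0) at_infinity"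
    by (intro tendsto_intros nev_expansion_tendsto[OF assms] tendsto_inverse_imaginary_axis)
  moreover have "eventually (\<lambda>y::real. y \<noteq> 0) at_infinity"
    by (auto simp: eventually_at_infinity intro!: exI[of _ 1])
  then have "eventually (\<lambda>y. (?r (Suc N) y - of_real (s (Suc N))) * inverse (?z y) = ?r N y) at_infinity"
    by eventually_elim (simp add: field_simps)
  ultimately show "(?r N \<longlongrightarrow> 0) at_infinity"
    by (simp add: tendsto_cong)
qed

lemma nev_expansion_mono:
  assumes "nev_expansion m s N" "K \<le> N"
  shows "nev_expansion m s K"
  using assms(2,1) by (induction rule: inc_induct) (auto dest: nev_expansion_Suc)

text \<open>The moments are recovered along the points i(k+1), because monotone and dominated
  convergence are applied to sequences; \<open>Suc\<close> keeps the points off the real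
  axis.\<close>

lemma filterlim_Suc_at_infinity: "filterlim (\<lambda>m. real (Suc m)) at_infinity sequentially"
  by (rule filterlim_mono[OF _ at_top_le_at_infinity order_refl])
     (intro filterlim_compose[OF filterlim_real_sequentially] filterlim_Suc)

lemma nev_expansion_LIMSEQ:
  assumes "nev_expansion m s N"
  shows "(\<lambda>k. (m (\<i> * of_real (real (Suc k))) + (\<Sum>i\<le>N. of_real (s i) / (\<i> * of_real (real (Suc k))) ^ (i + 1)))
           * (\<i> * of_real (real (Suc k))) ^ (N + 1)) \<longlonglongrightarrow> 0"
  using filterlim_compose[OF nev_expansion_tendsto[OF assms] filterlim_Suc_at_infinity] .

text \<open>Meant for the iterated transforms, whose closed form is available only off the real
  axis.\<close>

lemma nev_expansion_cong:
  assumes "\<And>z. z \<notin> \<real> \<Longrightarrow> m z = m' z" "nev_expansion m s N"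
  shows "nev_expansion m' s N"
proof (rule nev_expansionI)
  have "eventually (\<lambda>y::real. y \<noteq> 0) at_infinity"
    by (auto simp: eventually_at_infinity intro!: exI[of _ 1])
  then have "eventually (\<lambda>y. (m (\<i> * of_real y) + (\<Sum>i\<le>N. of_real (s i) / (\<i> * of_real y) ^ (i + 1))) * (\<i> * of_real y) ^ (N + 1)
      = (m' (\<i> * of_real y) + (\<Sum>i\<le>N. of_real (s i) / (\<i> * of_real y) ^ (i + 1))) * (\<i> * of_real y) ^ (N + 1)) at_infinity"
    by eventually_elim (simp add: assms(1) complex_is_Real_iff)
  from tendsto_cong[OF this] nev_expansion_tendsto[OF assms(2)]
  show "((\<lambda>y. (m' (\<i> * of_real y) + (\<Sum>i\<le>N. of_real (s i) / (\<i> * of_real y) ^ (i + 1)))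
           * (\<i> * of_real y) ^ (N + 1)) \<longlongrightarrow> 0) at_infinity"
    by simp
qed

text \<open>The difference of the two scaled remainders is (tau_0 - tau'_0) z + (tau_1 - tau'_1).
  For z = iy the first term is purely imaginary, so real parts settle the second coefficient;
  division by z then settles the first.\<close>

lemma nev_expansion_1_unique:
  assumes "nev_expansion m \<tau> 1" "nev_expansion m \<tau>' 1"
  shows "\<tau> 0 = \<tau>' 0" "\<tau> 1 = \<tau>' 1"
proof -
  let ?z = "\<lambda>y::real. \<i> * of_real y :: complex"
  have ev: "eventually (\<lambda>y::real. y \<noteq> 0) at_infinity"
    by (auto simp: eventually_at_infinity intro!: exI[of _ 1])
  have nt: "(at_infinity :: real filter) \<noteq> bot"
    by (rule trivial_limit_at_infinity)
  have lim: "((\<lambda>y. of_real (\<tau> 0 - \<tau>' 0) * ?z y + of_real (\<tau> 1 - \<tau>' 1)) \<longlongrightarrow> 0) at_infinity"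
  proof (rule Lim_transform_eventually)
    show "((\<lambda>y. (m (?z y) + (\<Sum>i\<le>1. of_real (\<tau> i) / ?z y ^ (i + 1))) * ?z y ^ (1 + 1)
        - (m (?z y) + (\<Sum>i\<le>1. of_real (\<tau>' i) / ?z y ^ (i + 1))) * ?z y ^ (1 + 1)) \<longlongrightarrow> 0) at_infinity"
      using tendsto_diff[OF nev_expansion_tendsto[OF assms(1)] nev_expansion_tendsto[OF assms(2)]] by simp
    show "eventually (\<lambda>y. (m (?z y) + (\<Sum>i\<le>1. of_real (\<tau> i) / ?z y ^ (i + 1))) * ?z y ^ (1 + 1)
        - (m (?z y) + (\<Sum>i\<le>1. of_real (\<tau>' i) / ?z y ^ (i + 1))) * ?z y ^ (1 + 1)
        = of_real (\<tau> 0 - \<tau>' 0) * ?z y + of_real (\<tau> 1 - \<tau>' 1)) at_infinity"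
      using ev by eventually_elim (simp add: field_simps power2_eq_square)
  qed
  have "((\<lambda>y. Re (of_real (\<tau> 0 - \<tau>' 0) * ?z y + of_real (\<tau> 1 - \<tau>' 1))) \<longlongrightarrow> Re 0) at_infinity"
    by (intro tendsto_Re lim)
  then have "((\<lambda>y::real. \<tau> 1 - \<tau>' 1) \<longlongrightarrow> 0) at_infinity" by simp
  from tendsto_unique[OF nt tendsto_const this] show 1: "\<tau> 1 = \<tau>' 1" by simp
  have "((\<lambda>y. (of_real (\<tau> 0 - \<tau>' 0) * ?z y + of_real (\<tau> 1 - \<tau>' 1)) * inverse (?z y)) \<longlongrightarrow> 0 * 0) at_infinity"
    by (intro tendsto_mult lim tendsto_inverse_imaginary_axis)
  moreover have "eventually (\<lambda>y. (of_real (\<tau> 0 - \<tau>' 0) * ?z y + of_real (\<tau> 1 - \<tau>' 1)) * inverse (?z y)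
        = of_real (\<tau> 0 - \<tau>' 0)) at_infinity"
    using ev by eventually_elim (simp add: 1[simplified] field_simps)
  ultimately have "((\<lambda>y::real. of_real (\<tau> 0 - \<tau>' 0) :: complex) \<longlongrightarrow> 0) at_infinity"
    by (simp add: tendsto_cong)
  from tendsto_unique[OF nt tendsto_const this] show "\<tau> 0 = \<tau>' 0" by simp
qed

text \<open>By uniqueness, any expansion at hand may replace the one picked by
  \<open>SOME\<close>.\<close>

lemma schur_transform_eq:
  assumes "nev_expansion m \<tau> 1"
  shows "schur_transform m z = - of_real (\<tau> 0) / m z - z + of_real (\<tau> 1) / of_real (\<tau> 0)"
proof -
  have "nev_expansion m (SOME \<tau>. nev_expansion m \<tau> 1) 1"
    using assms by (rule someI[of "\<lambda>\<tau>. nev_expansion m \<tau> 1"])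
  from nev_expansion_1_unique[OF this assms] show ?thesis
    by (simp add: schur_transform_def Let_def)
qed

section \<open>Moments\<close>

text \<open>The finite geometric series in t/z with its exact remainder; integrated, it turns the
  remainder of the expansion of n into a single integral.\<close>

lemma inverse_geometric_expansion:
  fixes t z :: "'a :: field"
  assumes "z \<noteq> 0" "t \<noteq> z"
  shows "1 / (t - z) + (\<Sum>i<N. t ^ i / z ^ (i + 1)) = t ^ N / (z ^ N * (t - z))"
proof (induction N)
  case (Suc N)
  have "1 / (t - z) + (\<Sum>i<Suc N. t ^ i / z ^ (i + 1)) = t ^ N / (z ^ N * (t - z)) + t ^ N / z ^ (N + 1)"
    using Suc by simp
  also have "\<dots> = t ^ Suc N / (z ^ Suc N * (t - z))"
    using assms by (simp add: divide_simps) (simp add: algebra_simps)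
  finally show ?case .
qed simp

lemma nonreal_not_of_real: "z \<notin> \<real> \<Longrightarrow> complex_of_real t \<noteq> z"
  by auto

lemma cmod_resolvent_kernel_le:
  assumes "z \<notin> \<real>"
  shows "cmod (1 / (of_real t - z)) \<le> 1 / \<bar>Im z\<bar>"
proof -
  have "Im z \<noteq> 0" using assms complex_is_Real_iff by blast
  moreover have "\<bar>Im z\<bar> \<le> cmod (of_real t - z)"
    using abs_Im_le_cmod[of "of_real t - z"] by simp
  ultimately show ?thesis by (simp add: norm_divide divide_simps)
qed

lemma resolvent_kernel_measurable:
  assumes "sets M = sets borel"
  shows "(\<lambda>t. 1 / (complex_of_real t - z)) \<in> borel_measurable M"
  by (subst measurable_cong_sets[OF assms refl]) measurable

lemma resolvent_kernel_mult_integrable: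
  fixes f :: "real \<Rightarrow> complex"
  assumes "integrable M f" "sets M = sets borel" "z \<notin> \<real>"
  shows "integrable M (\<lambda>t. f t / (of_real t - z))"
proof (rule Bochner_Integration.integrable_bound)
  show "integrable M (\<lambda>t. norm (f t) * (1 / \<bar>Im z\<bar>))"
    using assms(1) by simp
  show "(\<lambda>t. f t / (of_real t - z)) \<in> borel_measurable M"
    using borel_measurable_times[OF borel_measurable_integrable[OF assms(1)]
        resolvent_kernel_measurable[OF assms(2), of z]] by simp
  show "AE t in M. norm (f t / (of_real t - z)) \<le> norm (norm (f t) * (1 / \<bar>Im z\<bar>))"
    using mult_left_mono[OF cmod_resolvent_kernel_le[OF assms(3)] norm_ge_zero]
    by (intro AE_I2) (simp add: norm_divide)
qed

text \<open>The integrand on the right is a finite sum of integrable terms, so the formula makes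
  sense before anything is known about moment N. This is what allows moments N and N + 1 to be
  extracted from it.\<close>

lemma stieltjes_remainder:
  fixes s :: "nat \<Rightarrow> real" and z :: complex
  assumes "finite_measure M" "sets M = sets borel" "z \<notin> \<real>"
    and int: "\<And>i. i < N \<Longrightarrow> integrable M (\<lambda>t. t ^ i)"
    and s: "\<And>i. i < N \<Longrightarrow> s i = (LINT t|M. t ^ i)"
  shows "(LINT t|M. 1 / (of_real t - z)) + (\<Sum>i<N. of_real (s i) / z ^ (i + 1))
       = (LINT t|M. of_real (t ^ N) / (z ^ N * (of_real t - z)))"
proof -
  interpret finite_measure M by fact
  have [simp]: "z \<noteq> 0" using assms(3) by auto
  have i1: "integrable M (\<lambda>t. 1 / (of_real t - z))"
    using resolvent_kernel_mult_integrable[of M "\<lambda>_. 1" z] assms by simp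
  have i2: "integrable M (\<lambda>t. complex_of_real (t ^ i) / z ^ (i + 1))" if "i \<in> {..<N}" for i
    using int[of i] that by (intro integrable_divide integrable_of_real) auto
  have "(LINT t|M. of_real (t ^ N) / (z ^ N * (of_real t - z)))
      = (LINT t|M. 1 / (of_real t - z) + (\<Sum>i<N. of_real (t ^ i) / z ^ (i + 1)))"
    using inverse_geometric_expansion[OF \<open>z \<noteq> 0\<close> nonreal_not_of_real[OF assms(3)], of _ N] by simp
  also have "\<dots> = (LINT t|M. 1 / (of_real t - z)) + (\<Sum>i<N. LINT t|M. of_real (t ^ i) / z ^ (i + 1))"
    by (subst Bochner_Integration.integral_add[OF i1 Bochner_Integration.integrable_sum[OF i2]],
        assumption, subst Bochner_Integration.integral_sum[OF i2], assumption, rule refl)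
  also have "(\<Sum>i<N. LINT t|M. of_real (t ^ i) / z ^ (i + 1)) = (\<Sum>i<N. of_real (s i) / z ^ (i + 1))"
    by (intro sum.cong refl) (use s in \<open>simp del: of_real_power add: integral_of_real\<close>)
  finally show ?thesis by simp
qed

lemma imaginary_kernel: 
  fixes t y :: real
  assumes "y \<noteq> 0"
  shows "1 / (of_real t - \<i> * of_real y) = Complex (t / (t\<^sup>2 + y\<^sup>2)) (y / (t\<^sup>2 + y\<^sup>2))"
  using assms by (simp add: complex_eq_iff Re_divide Im_divide)

section \<open>Poisson weights and the recovery of moments\<close>

lemma poisson_weight_le:
  fixes t y :: real
  shows "0 \<le> y\<^sup>2 / (t\<^sup>2 + y\<^sup>2)" "y\<^sup>2 / (t\<^sup>2 + y\<^sup>2) \<le> 1"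
  by (auto simp: divide_simps sum_power2_gt_zero_iff)

lemma poisson_weight_mono:
  fixes t x y :: real
  assumes "0 < x" "x \<le> y"
  shows "x\<^sup>2 / (t\<^sup>2 + x\<^sup>2) \<le> y\<^sup>2 / (t\<^sup>2 + y\<^sup>2)"
proof -
  have "x\<^sup>2 * t\<^sup>2 \<le> y\<^sup>2 * t\<^sup>2"
    using assms by (intro mult_right_mono power_mono) auto
  then have num: "x\<^sup>2 * (t\<^sup>2 + y\<^sup>2) - y\<^sup>2 * (t\<^sup>2 + x\<^sup>2) \<le> 0"
    by (simp add: algebra_simps)
  have pos: "t\<^sup>2 + x\<^sup>2 > 0" "t\<^sup>2 + y\<^sup>2 > 0"
    using assms by (auto intro!: add_nonneg_pos)
  have "x\<^sup>2 / (t\<^sup>2 + x\<^sup>2) - y\<^sup>2 / (t\<^sup>2 + y\<^sup>2)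
      = (x\<^sup>2 * (t\<^sup>2 + y\<^sup>2) - y\<^sup>2 * (t\<^sup>2 + x\<^sup>2)) / ((t\<^sup>2 + x\<^sup>2) * (t\<^sup>2 + y\<^sup>2))"
    using pos by (intro diff_frac_eq) auto
  also have "\<dots> \<le> 0"
    by (rule divide_nonpos_pos[OF num mult_pos_pos[OF pos]])
  finally show ?thesis by simp
qed

lemma poisson_weight_LIMSEQ:
  "(\<lambda>m. (real (Suc m))\<^sup>2 / (t\<^sup>2 + (real (Suc m))\<^sup>2)) \<longlonglongrightarrow> 1"
proof -
  have "(\<lambda>m. inverse ((t * inverse (real (Suc m)))\<^sup>2 + 1)) \<longlonglongrightarrow> inverse ((t * 0)\<^sup>2 + 1)"
    by (intro tendsto_intros LIMSEQ_inverse_real_of_nat) auto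
  moreover have "inverse ((t * inverse (real (Suc m)))\<^sup>2 + 1) = (real (Suc m))\<^sup>2 / (t\<^sup>2 + (real (Suc m))\<^sup>2)" for m
  proof -
    have "(t * inverse (real (Suc m)))\<^sup>2 + 1 = (t\<^sup>2 + (real (Suc m))\<^sup>2) / (real (Suc m))\<^sup>2"
      by (simp add: add_divide_distrib power_mult_distrib power_inverse divide_inverse[of "t\<^sup>2"] del: of_nat_Suc)
    then show ?thesis by simp
  qed
  ultimately show ?thesis by simp
qed

text \<open>Even powers are nonnegative and the weights increase to 1, so monotone convergence
  yields integrability and the value together.\<close>

lemma even_moment_of_poisson_limit:
  assumes "sets M = sets borel"
    and int: "\<And>m. integrable M (\<lambda>t. t ^ (2 * k) * ((real (Suc m))\<^sup>2 / (t\<^sup>2 + (real (Suc m))\<^sup>2)))"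
    and lim: "(\<lambda>m. LINT t|M. t ^ (2 * k) * ((real (Suc m))\<^sup>2 / (t\<^sup>2 + (real (Suc m))\<^sup>2))) \<longlonglongrightarrow> L"
  shows "integrable M (\<lambda>t. t ^ (2 * k))" "(LINT t|M. t ^ (2 * k)) = L"
proof -
  let ?f = "\<lambda>m t. t ^ (2 * k) * ((real (Suc m))\<^sup>2 / (t\<^sup>2 + (real (Suc m))\<^sup>2))"
  have 1: "AE t in M. mono (\<lambda>m. ?f m t)"
    by (intro AE_I2 monoI mult_left_mono poisson_weight_mono) auto
  have 2: "AE t in M. 0 \<le> ?f m t" for m
    by (intro AE_I2 mult_nonneg_nonneg poisson_weight_le) auto
  have 3: "AE t in M. (\<lambda>m. ?f m t) \<longlonglongrightarrow> t ^ (2 * k)"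
    using tendsto_mult[OF tendsto_const poisson_weight_LIMSEQ] by (intro AE_I2) fastforce
  have 4: "(\<lambda>t. t ^ (2 * k)) \<in> borel_measurable M"
    by (subst measurable_cong_sets[OF assms(1) refl]) measurable
  show "integrable M (\<lambda>t. t ^ (2 * k))" "(LINT t|M. t ^ (2 * k)) = L"
    using integral_monotone_convergence_nonneg[OF int 1 2 3 lim 4] by auto
qed

text \<open>The product of iy and 1/(t - iy) has real part -y^2/(t^2 + y^2), so the expansion says
  that the Poisson-weighted masses tend to s_0.\<close>

lemma moment_0_of_expansion:
  assumes "finite_measure M" "sets M = sets borel"
    and n: "\<And>z. z \<notin> \<real> \<Longrightarrow> n z = (LINT t|M. 1 / (of_real t - z))"
    and "nev_expansion n s 0"
  shows "s 0 = measure M (space M)"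
proof -
  interpret finite_measure M by fact
  let ?y = "\<lambda>m. real (Suc m)"
  let ?w = "\<lambda>m t. t ^ (2 * 0) * ((?y m)\<^sup>2 / (t\<^sup>2 + (?y m)\<^sup>2))"
  have meas: "?w m \<in> borel_measurable M" for m
    by (subst measurable_cong_sets[OF assms(2) refl]) measurable
  have int: "integrable M (?w m)" for m
    by (rule Bochner_Integration.integrable_bound[OF integrable_const[of "1::real"] meas])
      (rule AE_I2, use poisson_weight_le[of "?y m"] in \<open>simp del: of_nat_Suc\<close>)
  have eq: "Re (n (\<i> * of_real (?y m)) * (\<i> * of_real (?y m))) = - (LINT t|M. ?w m t)" for m
  proof -
    let ?z = "\<i> * of_real (?y m) :: complex"
    have z: "?z \<notin> \<real>" by (simp add: complex_is_Real_iff)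
    have i: "integrable M (\<lambda>t. 1 / (of_real t - ?z))"
      using resolvent_kernel_mult_integrable[of M "\<lambda>_. 1" ?z] assms z by simp
    have "n ?z * ?z = (LINT t|M. 1 / (of_real t - ?z) * ?z)"
      unfolding n[OF z] by (rule integral_mult_left_zero[symmetric])
    also have "Re \<dots> = (LINT t|M. Re (1 / (of_real t - ?z) * ?z))"
      using i by (intro integral_Re[symmetric] integrable_mult_left) simp
    also have "\<dots> = (LINT t|M. - ?w m t)"
      by (subst imaginary_kernel) (simp_all add: power2_eq_square)
    finally show ?thesis by simp
  qed
  have "(\<lambda>m. n (\<i> * of_real (?y m)) * (\<i> * of_real (?y m)) + of_real (s 0)) \<longlonglongrightarrow> 0"
    using nev_expansion_LIMSEQ[OF assms(4)] by (simp add: distrib_right del: of_nat_Suc)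
  from tendsto_Re[OF this] have "(\<lambda>m. s 0 - (LINT t|M. ?w m t)) \<longlonglongrightarrow> 0"
    unfolding plus_complex.sel eq by simp
  from tendsto_diff[OF tendsto_const[of "s 0"] this]
  have "(\<lambda>m. LINT t|M. ?w m t) \<longlonglongrightarrow> s 0" by simp
  from even_moment_of_poisson_limit(2)[OF assms(2) int this] show ?thesis by simp
qed

text \<open>One limit, z^2 G + s_(2k+1) z + s_(2k+2) \<rightarrow> 0 with z = iy, yields two
  moments. Its real part contains y^2 Re G, the weighted even moment, to which monotone convergence
  applies. The odd integrand changes sign, so it has to come second, by dominated convergence with
  the even moment in the bound.\<close>

lemma moments_step_of_expansion:
  assumes "finite_measure M" "sets M = sets borel"
    and n: "\<And>z. z \<notin> \<real> \<Longrightarrow> n z = (LINT t|M. 1 / (of_real t - z))"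
    and exp: "nev_expansion n s (2 * k + 2)"
    and int: "\<And>i. i \<le> 2 * k \<Longrightarrow> integrable M (\<lambda>t. t ^ i)"
    and s: "\<And>i. i \<le> 2 * k \<Longrightarrow> s i = (LINT t|M. t ^ i)"
  shows "integrable M (\<lambda>t. t ^ (2 * k + 1))" "s (2 * k + 1) = (LINT t|M. t ^ (2 * k + 1))"
    and "integrable M (\<lambda>t. t ^ (2 * k + 2))" "s (2 * k + 2) = (LINT t|M. t ^ (2 * k + 2))"
proof -
  interpret finite_measure M by fact
  define y where "y = (\<lambda>m. real (Suc m))"
  define z where "z = (\<lambda>m. \<i> * complex_of_real (y m))"
  define w where "w = (\<lambda>m t. (y m)\<^sup>2 / (t\<^sup>2 + (y m)\<^sup>2))"
  define G where "G = (\<lambda>m. LINT t|M. of_real (t ^ (2 * k + 1)) / (of_real t - z m))"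
  have y0: "y m \<noteq> 0" for m by (simp add: y_def)
  have z: "z m \<notin> \<real>" for m using y0 by (simp add: complex_is_Real_iff z_def)
  have z0: "z m \<noteq> 0" for m using z[of m] by auto
  have kernel: "of_real (t ^ (2 * k + 1)) / (of_real t - z m)
      = Complex (t ^ (2 * k + 2) / (t\<^sup>2 + (y m)\<^sup>2)) (t ^ (2 * k + 1) * y m / (t\<^sup>2 + (y m)\<^sup>2))" for m t
  proof -
    have "of_real (t ^ (2 * k + 1)) / (of_real t - z m) = of_real (t ^ (2 * k + 1)) * (1 / (of_real t - z m))"
      by simp
    also have "\<dots> = of_real (t ^ (2 * k + 1)) * Complex (t / (t\<^sup>2 + (y m)\<^sup>2)) (y m / (t\<^sup>2 + (y m)\<^sup>2))"
      unfolding z_def by (subst imaginary_kernel[OF y0]) simp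
    also have "\<dots> = Complex (t ^ (2 * k + 2) / (t\<^sup>2 + (y m)\<^sup>2)) (t ^ (2 * k + 1) * y m / (t\<^sup>2 + (y m)\<^sup>2))"
      by (simp add: complex_eq_iff del: of_real_power of_real_mult)
    finally show ?thesis .
  qed
  \<comment> \<open>The splitting t^(2k+1)/(t-z) = t^(2k) + z t^(2k)/(t-z) uses no moment beyond
    2k.\<close>
  have iG: "integrable M (\<lambda>t. of_real (t ^ (2 * k + 1)) / (of_real t - z m))" for m
  proof -
    have i: "integrable M (\<lambda>t. complex_of_real (t ^ (2 * k)))"
      using int by (intro integrable_of_real) auto
    have "integrable M (\<lambda>t. complex_of_real (t ^ (2 * k)) + z m * (of_real (t ^ (2 * k)) / (of_real t - z m)))"
      by (intro Bochner_Integration.integrable_add integrable_mult_right i resolvent_kernel_mult_integrable[OF i assms(2) z])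
    moreover have "complex_of_real (t ^ (2 * k)) + z m * (of_real (t ^ (2 * k)) / (of_real t - z m))
        = of_real (t ^ (2 * k + 1)) / (of_real t - z m)" for t
      using nonreal_not_of_real[OF z[of m], of t] by (simp add: field_simps)
    ultimately show ?thesis by simp
  qed
  have ReG: "(y m)\<^sup>2 * Re (G m) = (LINT t|M. t ^ (2 * (k + 1)) * w m t)"
    and iw: "integrable M (\<lambda>t. t ^ (2 * (k + 1)) * w m t)" for m
  proof -
    have 1: "t ^ (2 * (k + 1)) * w m t = (y m)\<^sup>2 * Re (of_real (t ^ (2 * k + 1)) / (of_real t - z m))" for t
      unfolding kernel w_def by simp
    show "(y m)\<^sup>2 * Re (G m) = (LINT t|M. t ^ (2 * (k + 1)) * w m t)"
      unfolding 1 G_def by (subst integral_Re[OF iG, symmetric]) simp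
    show "integrable M (\<lambda>t. t ^ (2 * (k + 1)) * w m t)"
      unfolding 1 by (intro integrable_mult_right integrable_Re iG)
  qed
  have ImG: "y m * Im (G m) = (LINT t|M. t ^ (2 * k + 1) * w m t)" for m
  proof -
    have 1: "t ^ (2 * k + 1) * w m t = y m * Im (of_real (t ^ (2 * k + 1)) / (of_real t - z m))" for t
      unfolding kernel w_def by (simp add: power2_eq_square)
    show ?thesis
      unfolding 1 G_def by (subst integral_Im[OF iG, symmetric]) simp
  qed
  have rem: "(n (z m) + (\<Sum>i\<le>2 * k + 2. of_real (s i) / z m ^ (i + 1))) * z m ^ (2 * k + 2 + 1)
      = (z m)\<^sup>2 * G m + of_real (s (2 * k + 1)) * z m + of_real (s (2 * k + 2))" for m
  proof -
    have "n (z m) + (\<Sum>i<2 * k + 1. of_real (s i) / z m ^ (i + 1))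
        = (LINT t|M. of_real (t ^ (2 * k + 1)) / (z m ^ (2 * k + 1) * (of_real t - z m)))"
      unfolding n[OF z] by (rule stieltjes_remainder[OF assms(1,2) z]) (use int s in auto)
    also have "\<dots> = (LINT t|M. of_real (t ^ (2 * k + 1)) / (of_real t - z m) * (1 / z m ^ (2 * k + 1)))"
      by (simp add: mult.commute)
    also have "\<dots> = G m / z m ^ (2 * k + 1)"
      unfolding G_def by (subst integral_mult_left_zero) simp
    finally have "n (z m) + (\<Sum>i\<le>2 * k + 2. of_real (s i) / z m ^ (i + 1))
        = G m / z m ^ (2 * k + 1) + of_real (s (2 * k + 1)) / z m ^ (2 * k + 2) + of_real (s (2 * k + 2)) / z m ^ (2 * k + 3)"
      by (simp add: lessThan_Suc_atMost[symmetric] add.assoc[symmetric] numeral_2_eq_2 numeral_3_eq_3 del: power_Suc)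
    then show ?thesis
      using z0[of m] by (simp add: field_simps eval_nat_numeral)
  qed
  have lim: "(\<lambda>m. (z m)\<^sup>2 * G m + of_real (s (2 * k + 1)) * z m + of_real (s (2 * k + 2))) \<longlonglongrightarrow> 0"
    unfolding rem[symmetric] unfolding z_def y_def by (rule nev_expansion_LIMSEQ[OF exp])
  have "(\<lambda>m. s (2 * k + 2) - (y m)\<^sup>2 * Re (G m)) \<longlonglongrightarrow> 0"
    using tendsto_Re[OF lim] by (simp add: z_def power_mult_distrib flip: of_real_power)
  from tendsto_diff[OF tendsto_const[of "s (2 * k + 2)"] this]
  have "(\<lambda>m. LINT t|M. t ^ (2 * (k + 1)) * w m t) \<longlonglongrightarrow> s (2 * k + 2)"
    by (simp add: ReG)
  from even_moment_of_poisson_limit[OF assms(2) iw[unfolded w_def y_def] this[unfolded w_def y_def]]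
  show even: "integrable M (\<lambda>t. t ^ (2 * k + 2))" "s (2 * k + 2) = (LINT t|M. t ^ (2 * k + 2))"
    by auto
  have meas: "(\<lambda>t. t ^ i) \<in> borel_measurable M" "(\<lambda>t. t ^ i * w m t) \<in> borel_measurable M" for i m
    unfolding w_def by (subst measurable_cong_sets[OF assms(2) refl]; measurable)+
  have bound: "\<bar>t ^ (2 * k + 1)\<bar> \<le> 1 + t ^ (2 * k + 2)" for t :: real
  proof (cases "\<bar>t\<bar> \<le> 1")
    case True
    then have "\<bar>t ^ (2 * k + 1)\<bar> \<le> 1" unfolding power_abs by (intro power_le_one) auto
    moreover have "t ^ (2 * k + 2) \<ge> 0" by (rule zero_le_even_power) simp
    ultimately show ?thesis by simp
  next
    case False
    then have "\<bar>t\<bar> ^ (2 * k + 1) \<le> \<bar>t\<bar> ^ (2 * k + 2)" by (intro power_increasing) auto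
    also have "\<dots> = t ^ (2 * k + 2)" by (simp add: power_even_abs)
    finally show ?thesis unfolding power_abs by linarith
  qed
  have idom: "integrable M (\<lambda>t. 1 + t ^ (2 * k + 2))"
    using even by simp
  show "integrable M (\<lambda>t. t ^ (2 * k + 1))"
  proof (rule Bochner_Integration.integrable_bound[OF idom meas(1)], rule AE_I2)
    fix t :: real
    show "norm (t ^ (2 * k + 1)) \<le> norm (1 + t ^ (2 * k + 2))"
      using bound[of t] abs_ge_self[of "1 + t ^ (2 * k + 2)"] unfolding real_norm_def by linarith
  qed
  have "(\<lambda>m. y m * Im (G m)) \<longlonglongrightarrow> (LINT t|M. t ^ (2 * k + 1))"
    unfolding ImG
  proof (rule integral_dominated_convergence[OF meas idom])
    show "AE t in M. (\<lambda>m. t ^ (2 * k + 1) * w m t) \<longlonglongrightarrow> t ^ (2 * k + 1)"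
      using tendsto_mult[OF tendsto_const poisson_weight_LIMSEQ]
      unfolding w_def y_def by (intro AE_I2) fastforce
    show "AE t in M. norm (t ^ (2 * k + 1) * w m t) \<le> 1 + t ^ (2 * k + 2)" for m
    proof (rule AE_I2)
      fix t
      have "norm (t ^ (2 * k + 1) * w m t) = \<bar>t ^ (2 * k + 1)\<bar> * w m t"
        using poisson_weight_le(1) unfolding w_def real_norm_def abs_mult by (simp only: abs_of_nonneg)
      also have "\<dots> \<le> \<bar>t ^ (2 * k + 1)\<bar> * 1"
        unfolding w_def by (intro mult_left_mono poisson_weight_le) auto
      finally show "norm (t ^ (2 * k + 1) * w m t) \<le> 1 + t ^ (2 * k + 2)"
        using bound[of t] by linarith
    qed
  qed
  moreover have "(\<lambda>m. y m * Im (G m)) \<longlonglongrightarrow> s (2 * k + 1)"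
  proof -
    \<comment> \<open>The imaginary part of \<open>lim\<close> reads s_(2k+1) y - y^2 Im G
      \<rightarrow> 0; dividing by y leaves y Im G, the weighted odd moment of
      \<open>ImG\<close>.\<close>
    have "(\<lambda>m. (s (2 * k + 1) * y m - (y m)\<^sup>2 * Im (G m)) * inverse (y m)) \<longlonglongrightarrow> 0 * 0"
      using tendsto_Im[OF lim] LIMSEQ_inverse_real_of_nat
      by (intro tendsto_mult) (simp_all add: z_def y_def power_mult_distrib flip: of_real_power)
    moreover have "(s (2 * k + 1) * y m - (y m)\<^sup>2 * Im (G m)) * inverse (y m) = s (2 * k + 1) - y m * Im (G m)" for m
      using y0[of m] by (simp add: field_simps power2_eq_square)
    ultimately have "(\<lambda>m. s (2 * k + 1) - y m * Im (G m)) \<longlonglongrightarrow> 0" by simp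
    from tendsto_diff[OF tendsto_const[of "s (2 * k + 1)"] this] show ?thesis by simp
  qed
  ultimately show "s (2 * k + 1) = (LINT t|M. t ^ (2 * k + 1))"
    using LIMSEQ_unique by blast
qed

theorem moments_of_expansion:
  assumes "finite_measure M" "sets M = sets borel"
    and n: "\<And>z. z \<notin> \<real> \<Longrightarrow> n z = (LINT t|M. 1 / (of_real t - z))"
    and exp: "nev_expansion n s (2 * p)" and "i \<le> 2 * p"
  shows "integrable M (\<lambda>t. t ^ i)" "s i = (LINT t|M. t ^ i)"
proof -
  interpret finite_measure M by fact
  have "\<forall>i\<le>2 * k. integrable M (\<lambda>t. t ^ i) \<and> s i = (LINT t|M. t ^ i)" if "k \<le> p" for k
    using that
  proof (induction k)
    case 0
    then show ?case
      using moment_0_of_expansion[OF assms(1-3) nev_expansion_mono[OF exp]] by simp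
  next
    case (Suc k)
    then have IH: "\<And>i. i \<le> 2 * k \<Longrightarrow> integrable M (\<lambda>t. t ^ i)" "\<And>i. i \<le> 2 * k \<Longrightarrow> s i = (LINT t|M. t ^ i)"
      by auto
    have e: "nev_expansion n s (2 * k + 2)"
      by (rule nev_expansion_mono[OF exp]) (use Suc.prems in simp)
    note step = moments_step_of_expansion[OF assms(1,2) n e IH]
    have "i \<le> 2 * k \<or> i = 2 * k + 1 \<or> i = 2 * k + 2" if "i \<le> 2 * Suc k" for i
      using that by presburger
    then show ?case using IH step by blast
  qed
  then show "integrable M (\<lambda>t. t ^ i)" "s i = (LINT t|M. t ^ i)"
    using assms(5) by blast+
qed

text \<open>If q^2 had integral 0, then q would vanish almost everywhere and so would every integral
  of t^i q. These integrals are the entries of the Hankel matrix applied to the coefficient vector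
  of q, which would be a nonzero kernel vector.\<close>

lemma hankel_definite:
  fixes s :: "nat \<Rightarrow> real"
  assumes int: "\<And>i. i \<le> 2 * p \<Longrightarrow> integrable M (\<lambda>t. t ^ i)"
    and s: "\<And>i. i \<le> 2 * p \<Longrightarrow> s i = (LINT t|M. t ^ i)"
    and det: "Determinant.det (Matrix.mat (p + 1) (p + 1) (\<lambda>(i, l). s (i + l))) \<noteq> 0"
    and q: "q \<noteq> 0" "degree q \<le> p"
  shows "0 < (LINT t|M. (poly q t)\<^sup>2)"
proof (rule ccontr)
  assume "\<not> 0 < (LINT t|M. (poly q t)\<^sup>2)"
  then have 0: "(LINT t|M. (poly q t)\<^sup>2) = 0"
    by (metis Bochner_Integration.integral_nonneg less_eq_real_def zero_le_power2)
  have qt: "poly q t = (\<Sum>l<p + 1. Polynomial.coeff q l * t ^ l)" for t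
    unfolding poly_altdef using q(2) by (intro sum.mono_neutral_left) (auto simp: coeff_eq_0)
  have int': "integrable M (\<lambda>t. poly r t)" if "degree r \<le> 2 * p" for r
    unfolding poly_altdef using that
    by (intro Bochner_Integration.integrable_sum integrable_mult_right int) auto
  have "integrable M (\<lambda>t. (poly q t)\<^sup>2)"
    using int'[of "q * q"] degree_mult_le[of q q] q(2) by (simp add: power2_eq_square)
  from integral_nonneg_eq_0_iff_AE[OF this] have ae: "AE t in M. poly q t = 0"
    using 0 by simp
  define v where "v = Matrix.vec (p + 1) (Polynomial.coeff q)"
  let ?A = "Matrix.mat (p + 1) (p + 1) (\<lambda>(i, l). s (i + l))"
  have row: "(\<Sum>l<p + 1. s (i + l) * Polynomial.coeff q l) = 0" if "i \<le> p" for i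
  proof -
    have "(\<Sum>l<p + 1. s (i + l) * Polynomial.coeff q l) = (\<Sum>l<p + 1. LINT t|M. t ^ (i + l) * Polynomial.coeff q l)"
      using that s by (intro sum.cong refl) auto
    also have "\<dots> = (LINT t|M. (\<Sum>l<p + 1. t ^ (i + l) * Polynomial.coeff q l))"
      using that int by (intro Bochner_Integration.integral_sum[symmetric] integrable_mult_left) auto
    also have "\<dots> = (LINT t|M. t ^ i * poly q t)"
      unfolding qt sum_distrib_left power_add by (simp only: mult_ac)
    also have "\<dots> = 0"
      using ae by (intro integral_eq_zero_AE) (auto elim: eventually_mono)
    finally show ?thesis .
  qed
  have "?A *\<^sub>v v = 0\<^sub>v (p + 1)"
  proof (rule eq_vecI)
    fix i assume "i < dim_vec (0\<^sub>v (p + 1) :: real vec)"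
    then show "(?A *\<^sub>v v) $ i = 0\<^sub>v (p + 1) $ i"
      using row[of i] by (simp add: v_def scalar_prod_def lessThan_atLeast0)
  qed simp
  moreover have "v \<noteq> 0\<^sub>v (p + 1)"
  proof
    assume "v = 0\<^sub>v (p + 1)"
    then have "v $ degree q = 0" using q(2) by simp
    then show False using q by (simp add: v_def)
  qed
  moreover have "v \<in> carrier_vec (p + 1)" by (simp add: v_def)
  ultimately have "Determinant.det ?A = 0"
    by (subst det_0_iff_vec_prod_zero[of _ "p + 1"]) auto
  with det show False ..
qed

section \<open>Measures with moments up to a given order\<close>

text \<open>Apart from the integral representation of n, this collects all that the operator theory
  takes from n and the s_i.\<close>

locale moment_measure = finite_measure M for M :: "real measure" +
  fixes p :: nat
  assumes borel: "sets M = sets borel"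
    and moments: "\<And>i. i \<le> 2 * p \<Longrightarrow> integrable M (\<lambda>t. t ^ i)"
    and definite: "\<And>q. q \<noteq> 0 \<Longrightarrow> degree q \<le> p \<Longrightarrow> 0 < (LINT t|M. (poly q t)\<^sup>2)"
begin

section \<open>Orthonormal polynomials and Jacobi coefficients\<close>

abbreviation e :: "nat \<Rightarrow> real poly" where "e \<equiv> orthonormal_poly M"

definition poly_inner :: "real poly \<Rightarrow> real poly \<Rightarrow> real" where
  "poly_inner a b = (LINT t|M. poly a t * poly b t)"

lemma poly_integrable:
  assumes "degree q \<le> 2 * p"
  shows "integrable M (\<lambda>t. poly q t)"
  unfolding poly_altdef using assms
  by (intro Bochner_Integration.integrable_sum integrable_mult_right moments) auto

lemma poly_mult_integrable:
  assumes "degree a \<le> p" "degree b \<le> p"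
  shows "integrable M (\<lambda>t. poly a t * poly b t)"
  using poly_integrable[of "a * b"] degree_mult_le[of a b] assms by simp

lemma poly_inner_commute: "poly_inner a b = poly_inner b a"
  by (simp add: poly_inner_def mult.commute)

lemma poly_inner_diff:
  "degree a \<le> p \<Longrightarrow> degree b \<le> p \<Longrightarrow> degree c \<le> p \<Longrightarrow> poly_inner (a - b) c = poly_inner a c - poly_inner b c"
  by (simp add: poly_inner_def left_diff_distrib poly_mult_integrable)

lemma poly_inner_add:
  "degree a \<le> p \<Longrightarrow> degree b \<le> p \<Longrightarrow> degree c \<le> p \<Longrightarrow> poly_inner (a + b) c = poly_inner a c + poly_inner b c"
  by (simp add: poly_inner_def distrib_right poly_mult_integrable)

lemma poly_inner_smult: "poly_inner (Polynomial.smult c a) b = c * poly_inner a b"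
  by (simp add: poly_inner_def mult.assoc)

lemma poly_inner_zero: "poly_inner 0 b = 0"
  by (simp add: poly_inner_def)

lemma poly_inner_sum:
  assumes "\<And>i. i \<in> I \<Longrightarrow> degree (f i) \<le> p" "degree b \<le> p"
  shows "poly_inner (\<Sum>i\<in>I. f i) b = (\<Sum>i\<in>I. poly_inner (f i) b)"
  using assms
  by (induction I rule: infinite_finite_induct) (auto simp: poly_inner_zero poly_inner_add degree_sum_le)

lemma poly_inner_X_mult: "poly_inner ([:0, 1:] * a) b = poly_inner a ([:0, 1:] * b)"
  by (simp add: poly_inner_def ac_simps)

text \<open>The subtracted sum \<open>r\<close> has degree below k, so \<open>q\<close> is monic of
  degree k; being nonzero, it has positive norm by \<open>definite\<close>, and the normalisation is
  legitimate. All earlier e_i enter \<open>r\<close>, hence the strong induction.\<close>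

lemma gram_schmidt:
  "k \<le> p \<Longrightarrow> degree (e k) = k \<and> 0 < Polynomial.coeff (e k) k
     \<and> (\<forall>i<k. poly_inner (e k) (e i) = 0) \<and> poly_inner (e k) (e k) = 1"
proof (induction k rule: less_induct)
  case (less k)
  have deg: "degree (e i) = i" if "i < k" for i using less that by simp
  have ortho: "poly_inner (e l) (e i) = (if l = i then 1 else 0)" if "i < k" "l < k" for i l
    using less.IH[of i] less.IH[of l] less.prems that poly_inner_commute[of "e l" "e i"]
    by (cases i l rule: linorder_cases) auto
  define x where "x = (Polynomial.monom 1 k :: real poly)"
  define r where "r = (\<Sum>i<k. Polynomial.smult (poly_inner x (e i)) (e i))"
  define q where "q = x - r"
  have ek: "e k = Polynomial.smult (1 / sqrt (poly_inner q q)) q"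
    unfolding q_def r_def x_def poly_inner_def
    by (subst orthonormal_poly.simps) (simp add: Let_def power2_eq_square)
  have rc: "Polynomial.coeff r n = 0" if "k \<le> n" for n
    unfolding r_def using deg that by (auto simp: coeff_sum coeff_eq_0)
  have qk: "Polynomial.coeff q k = 1"
    by (simp add: q_def x_def rc)
  have "degree q \<le> k"
    by (rule degree_le) (auto simp: q_def x_def rc)
  moreover have "k \<le> degree q"
    by (rule le_degree) (simp add: qk)
  ultimately have dq: "degree q = k" by simp
  have "q \<noteq> 0" using qk by auto
  then have pos: "0 < poly_inner q q"
    using definite[of q] dq less.prems by (simp add: poly_inner_def power2_eq_square)
  have dx: "degree x \<le> p" using less.prems by (simp add: x_def degree_monom_eq)
  have dr: "degree r \<le> p"
    unfolding r_def using deg less.prems by (intro degree_sum_le) auto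
  have qe: "poly_inner q (e i) = 0" if "i < k" for i
  proof -
    have "poly_inner r (e i) = (\<Sum>l<k. poly_inner x (e l) * poly_inner (e l) (e i))"
      unfolding r_def using deg that less.prems by (subst poly_inner_sum) (auto simp: poly_inner_smult)
    also have "\<dots> = (\<Sum>l<k. if l = i then poly_inner x (e l) else 0)"
      using that by (intro sum.cong refl) (simp add: ortho)
    also have "\<dots> = poly_inner x (e i)"
      using that by simp
    finally show ?thesis
      unfolding q_def using dx dr deg[OF that] that less.prems by (subst poly_inner_diff) auto
  qed
  show ?case
    using dq qk pos qe by (auto simp: ek poly_inner_smult poly_inner_commute[of q "Polynomial.smult _ _"])
qed

lemma degree_e: "k \<le> p \<Longrightarrow> degree (e k) = k"
  and lead_coeff_e_pos: "k \<le> p \<Longrightarrow> 0 < Polynomial.coeff (e k) k"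
  using gram_schmidt by auto

lemma poly_inner_e: "i \<le> p \<Longrightarrow> j \<le> p \<Longrightarrow> poly_inner (e i) (e j) = (if i = j then 1 else 0)"
  using gram_schmidt[of i] gram_schmidt[of j] poly_inner_commute[of "e i" "e j"]
  by (cases i j rule: linorder_cases) auto

lemma coeff_e_eq_0: "k \<le> p \<Longrightarrow> k < n \<Longrightarrow> Polynomial.coeff (e k) n = 0"
  by (simp add: degree_e coeff_eq_0)

lemma degree_le_p:
  fixes q :: "real poly"
  assumes "\<And>n. n \<ge> k \<Longrightarrow> Polynomial.coeff q n = 0" "k \<le> p + 1"
  shows "degree q \<le> p"
  using assms by (intro degree_le) auto

text \<open>Subtracting c e_k, with c the quotient of the coefficients at t^k, lowers the bound by
  one; pairing with e_k then identifies c as the Fourier coefficient. Vanishing coefficients are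
  assumed in place of a degree bound so that the zero polynomial and k = 0 fit in.\<close>

lemma orthonormal_expansion:
  assumes "\<And>n. n \<ge> k \<Longrightarrow> Polynomial.coeff q n = 0" "k \<le> p + 1"
  shows "q = (\<Sum>i<k. Polynomial.smult (poly_inner q (e i)) (e i))"
  using assms
proof (induction k arbitrary: q)
  case 0
  then show ?case by (simp add: poly_eq_iff)
next
  case (Suc k)
  define c where "c = Polynomial.coeff q k / Polynomial.coeff (e k) k"
  define q' where "q' = q - Polynomial.smult c (e k)"
  have k: "k \<le> p" using Suc.prems by simp
  have dq: "degree q \<le> p" by (rule degree_le_p[OF Suc.prems])
  have q'c: "Polynomial.coeff q' n = 0" if "n \<ge> k" for n
    using that Suc.prems(1)[of n] lead_coeff_e_pos[OF k] coeff_e_eq_0[OF k, of n]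
    by (cases "n = k") (auto simp: q'_def c_def)
  have q': "q' = (\<Sum>i<k. Polynomial.smult (poly_inner q' (e i)) (e i))"
    by (rule Suc.IH[OF q'c]) (use k in auto)
  have pe: "poly_inner q' (e i) = poly_inner q (e i) - c * poly_inner (e k) (e i)" if "i \<le> k" for i
    unfolding q'_def using dq k that degree_e by (subst poly_inner_diff) (auto simp: poly_inner_smult)
  have "poly_inner q' (e k) = (\<Sum>i<k. poly_inner q' (e i) * poly_inner (e i) (e k))"
    using k degree_e by (subst q', subst poly_inner_sum) (auto simp: poly_inner_smult)
  also have "\<dots> = 0"
    using k by (intro sum.neutral) (auto simp: poly_inner_e)
  finally have c: "poly_inner q (e k) = c"
    using pe[of k] k by (simp add: poly_inner_e)
  have "q = q' + Polynomial.smult c (e k)" by (simp add: q'_def)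
  also have "q' = (\<Sum>i<k. Polynomial.smult (poly_inner q (e i)) (e i))"
    by (subst q') (intro sum.cong refl, use k pe in \<open>auto simp: poly_inner_e\<close>)
  finally show ?case by (simp add: c)
qed

lemma poly_inner_e_lower:
  assumes "\<And>n. n \<ge> k \<Longrightarrow> Polynomial.coeff q n = 0" "k \<le> p"
  shows "poly_inner q (e k) = 0"
proof -
  have "poly_inner q (e k) = (\<Sum>i<k. poly_inner q (e i) * poly_inner (e i) (e k))"
    using assms degree_e
    by (subst orthonormal_expansion[of k q], simp, simp, subst poly_inner_sum) (auto simp: poly_inner_smult)
  also have "\<dots> = 0"
    using assms by (intro sum.neutral) (auto simp: poly_inner_e)
  finally show ?thesis .
qed

text \<open>Entries of the Jacobi matrix, as matrix elements of multiplication by t. For k < p the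
  integrands have degree at most 2p; from k = p on the integrals need not exist.\<close>

definition jacobi_diag :: "nat \<Rightarrow> real" where "jacobi_diag k = poly_inner ([:0, 1:] * e k) (e k)"
definition jacobi_off :: "nat \<Rightarrow> real" where "jacobi_off k = poly_inner ([:0, 1:] * e k) (e (Suc k))"

lemma coeff_X_mult: "Polynomial.coeff ([:0, 1:] * q) (Suc n) = Polynomial.coeff q n"
  for q :: "real poly"
  by simp

text \<open>By degree, t e_k is a combination of e_0, ..., e_(k+1). Multiplication is symmetric, so
  t can be moved onto e_i, and t e_i has degree below k when i < k - 1; this leaves three
  terms.\<close>

lemma three_term_recurrence_e:
  assumes "k < p"
  shows "three_term_recurrence e jacobi_diag jacobi_off k"
proof -
  have c: "Polynomial.coeff ([:0, 1:] * e k) n = 0" if "n \<ge> Suc (Suc k)" for n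
    using that assms coeff_e_eq_0[of k "n - 1"] by (cases n) auto
  have exp: "[:0, 1:] * e k = (\<Sum>i<Suc (Suc k). Polynomial.smult (poly_inner ([:0, 1:] * e k) (e i)) (e i))"
    by (rule orthonormal_expansion[OF c]) (use assms in auto)
  show ?thesis
  proof (cases k)
    case 0
    then show ?thesis
      unfolding three_term_recurrence_def
      by (subst exp) (simp add: jacobi_diag_def jacobi_off_def)
  next
    case (Suc j)
    have "poly_inner ([:0, 1:] * e k) (e i) = 0" if "i < j" for i
    proof -
      have "poly_inner ([:0, 1:] * e i) (e k) = 0"
      proof (rule poly_inner_e_lower)
        fix n assume "k \<le> n"
        then show "Polynomial.coeff ([:0, 1:] * e i) n = 0"
          using that Suc assms coeff_e_eq_0[of i "n - 1"] by (cases n) auto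
      qed (use assms in simp)
      then show ?thesis by (metis poly_inner_X_mult poly_inner_commute)
    qed
    then have "(\<Sum>i<j. Polynomial.smult (poly_inner ([:0, 1:] * e k) (e i)) (e i)) = 0"
      by (intro sum.neutral) simp
    moreover have "poly_inner ([:0, 1:] * e k) (e j) = jacobi_off j"
      unfolding jacobi_off_def Suc by (metis poly_inner_X_mult poly_inner_commute)
    ultimately show ?thesis
      unfolding three_term_recurrence_def
      by (subst exp) (simp add: jacobi_diag_def jacobi_off_def Suc del: mult_pCons_left)
  qed
qed

text \<open>Only b_k e_(k+1) contributes to t^(k+1) in the recurrence. So b_k is a ratio of
  consecutive leading coefficients, which gives its sign and later makes the product of the norms of
  the u_j telescope.\<close>

lemma lead_coeff_e_Suc:
  assumes "k < p"
  shows "Polynomial.coeff (e k) k = jacobi_off k * Polynomial.coeff (e (Suc k)) (Suc k)"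
proof -
  have "Polynomial.coeff ([:0, 1:] * e k) (Suc k) = jacobi_off k * Polynomial.coeff (e (Suc k)) (Suc k)"
    using three_term_recurrence_e[OF assms] assms coeff_e_eq_0[of k "Suc k"] coeff_e_eq_0[of "k - 1" "Suc k"]
    unfolding three_term_recurrence_def by (auto simp del: mult_pCons_left)
  then show ?thesis by (simp only: coeff_X_mult)
qed

lemma jacobi_off_pos:
  assumes "k < p"
  shows "0 < jacobi_off k"
  using lead_coeff_e_Suc[OF assms] lead_coeff_e_pos[of k] lead_coeff_e_pos[of "Suc k"] assms
  by (metis Suc_leI less_imp_le zero_less_mult_pos2)

subsection \<open>The subspaces and the compressed operators\<close>

definition cpoly :: "real poly \<Rightarrow> real \<Rightarrow> complex" where
  "cpoly q = (\<lambda>t. of_real (poly q t))"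

abbreviation E :: "nat \<Rightarrow> real \<Rightarrow> complex" where "E k \<equiv> cpoly (e k)"

lemma cpoly_L2:
  assumes "degree q \<le> p"
  shows "cpoly q \<in> L2 M"
proof -
  have "(\<lambda>t. complex_of_real (poly q t)) \<in> borel_measurable M"
    using assms by (intro borel_measurable_integrable integrable_of_real poly_integrable) simp
  then show ?thesis
    using poly_mult_integrable[OF assms assms] by (simp add: L2_def cpoly_def power2_eq_square)
qed

lemma E_L2: "k \<le> p \<Longrightarrow> E k \<in> L2 M"
  by (simp add: cpoly_L2 degree_e)

lemma L2_inner_cpoly: "L2_inner M (cpoly a) (cpoly b) = of_real (poly_inner a b)"
  unfolding L2_inner_def cpoly_def poly_inner_def by (simp flip: of_real_mult)

lemma L2_inner_E: "i \<le> p \<Longrightarrow> j \<le> p \<Longrightarrow> L2_inner M (E i) (E j) = (if i = j then 1 else 0)"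
  by (simp add: L2_inner_cpoly poly_inner_e)

lemma mult_op_cpoly: "mult_op (cpoly q) = cpoly ([:0, 1:] * q)"
  by (simp add: mult_op_def cpoly_def)

lemma mult_op_power_u_gen: "(mult_op ^^ i) u_gen = cpoly (Polynomial.monom 1 i)"
proof (induction i)
  case 0
  then show ?case by (simp add: u_gen_def cpoly_def)
next
  case (Suc i)
  then show ?case by (simp add: mult_op_cpoly monom_Suc)
qed

lemma H_sub_L2: "f \<in> H_sub M j \<Longrightarrow> f \<in> L2 M"
  by (simp add: H_sub_def L2_ominus_def)

lemma H_sub_orthogonal_monom:
  assumes "f \<in> H_sub M j" "i < j"
  shows "L2_inner M f (cpoly (Polynomial.monom 1 i)) = 0"
proof -
  let ?g = "cpoly (Polynomial.monom 1 i)"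
  have "(\<lambda>t. \<Sum>f\<in>{?g}. 1 * f t) \<in> complex_span {(mult_op ^^ i) u_gen | i. i < j}"
    unfolding complex_span_def using assms(2) mult_op_power_u_gen
    by (intro CollectI exI[of _ "{?g}"] exI[of _ "\<lambda>_. 1"]) auto
  then show ?thesis
    using assms(1) by (simp add: H_sub_def L2_ominus_def)
qed

lemma H_sub_orthogonal:
  assumes "f \<in> H_sub M j" "j \<le> p + 1" "\<And>n. n \<ge> j \<Longrightarrow> Polynomial.coeff q n = 0"
  shows "L2_inner M f (cpoly q) = 0"
proof -
  have dq: "degree q < j \<or> q = 0"
    using assms(3)[of "degree q"] by (cases "q = 0") force+
  have "poly q t = (\<Sum>i<j. Polynomial.coeff q i * t ^ i)" for t
  proof -
    have "poly q t = (\<Sum>i\<le>degree q. Polynomial.coeff q i * t ^ i)" by (rule poly_altdef)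
    also have "\<dots> = (\<Sum>i<j. Polynomial.coeff q i * t ^ i)"
    proof (cases "q = 0")
      case False
      with dq show ?thesis
        by (intro sum.mono_neutral_left) (auto simp: coeff_eq_0)
    qed simp
    finally show ?thesis .
  qed
  then have q: "cpoly q = (\<lambda>t. \<Sum>i<j. of_real (Polynomial.coeff q i) * cpoly (Polynomial.monom 1 i) t)"
    by (simp add: cpoly_def poly_monom fun_eq_iff)
  have "L2_inner M f (cpoly q) = (\<Sum>i<j. L2_inner M f (\<lambda>t. of_real (Polynomial.coeff q i) * cpoly (Polynomial.monom 1 i) t))"
    unfolding q using assms(2)
    by (intro L2_inner_sum_right L2_scale cpoly_L2 H_sub_L2[OF assms(1)]) (auto simp: degree_monom_eq)
  also have "\<dots> = 0"
    using H_sub_orthogonal_monom[OF assms(1)] by (intro sum.neutral) (simp add: L2_inner_scale_right)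
  finally show ?thesis .
qed

lemma H_sub_orthogonal_E:
  assumes "f \<in> H_sub M j" "j \<le> p + 1" "i < j"
  shows "L2_inner M f (E i) = 0"
  by (rule H_sub_orthogonal[OF assms(1,2)]) (use assms coeff_e_eq_0[of i] in auto)

text \<open>Each monomial of degree below j is a combination of e_0, ..., e_(j-1), so orthogonality
  to the complex span of the t^i reduces to j orthonormal conditions.\<close>

lemma H_subI:
  assumes "f \<in> L2 M" "j \<le> p + 1" "\<And>i. i < j \<Longrightarrow> L2_inner M f (E i) = 0"
  shows "f \<in> H_sub M j"
proof -
  have mono: "L2_inner M f (cpoly (Polynomial.monom 1 i)) = 0" if "i < j" for i
  proof -
    let ?q = "Polynomial.monom 1 i :: real poly"
    have "?q = (\<Sum>l<j. Polynomial.smult (poly_inner ?q (e l)) (e l))"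
      by (rule orthonormal_expansion) (use that assms(2) in auto)
    then have "poly ?q t = (\<Sum>l<j. poly_inner ?q (e l) * poly (e l) t)" for t
      by (metis (no_types, lifting) poly_smult poly_sum sum.cong)
    then have q: "cpoly ?q = (\<lambda>t. \<Sum>l<j. of_real (poly_inner ?q (e l)) * E l t)"
      by (simp add: cpoly_def fun_eq_iff)
    have "L2_inner M f (cpoly ?q) = (\<Sum>l<j. L2_inner M f (\<lambda>t. of_real (poly_inner ?q (e l)) * E l t))"
      by (subst q, rule L2_inner_sum_right) (use assms E_L2 in \<open>auto intro: L2_scale\<close>)
    also have "\<dots> = 0"
      using assms(3) by (intro sum.neutral) (simp add: L2_inner_scale_right)
    finally show ?thesis .
  qed
  have "L2_inner M f g = 0" if "g \<in> complex_span {(mult_op ^^ i) u_gen | i. i < j}" for g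
  proof -
    from that obtain S c where S: "finite S" "S \<subseteq> {(mult_op ^^ i) u_gen | i. i < j}"
      and g: "g = (\<lambda>t. \<Sum>f\<in>S. c f * f t)"
      unfolding complex_span_def by auto
    have S': "h \<in> L2 M \<and> L2_inner M f h = 0" if "h \<in> S" for h
    proof -
      obtain i where "i < j" "h = cpoly (Polynomial.monom 1 i)"
        using S(2) \<open>h \<in> S\<close> mult_op_power_u_gen by auto
      then show ?thesis
        using mono assms(2) by (auto intro!: cpoly_L2 simp: degree_monom_eq)
    qed
    have "L2_inner M f g = (\<Sum>h\<in>S. L2_inner M f (\<lambda>t. c h * h t))"
      unfolding g using S' assms(1) by (intro L2_inner_sum_right L2_scale) auto
    also have "\<dots> = 0"
      using S' by (intro sum.neutral) (simp add: L2_inner_scale_right)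
    finally show ?thesis .
  qed
  then show ?thesis
    using assms(1) by (simp add: H_sub_def L2_ominus_def)
qed

lemma H_sub_0: "H_sub M 0 = L2 M"
  using H_subI[of _ 0] H_sub_L2 by auto

lemma H_sub_Suc_subset: "H_sub M (Suc j) \<subseteq> H_sub M j"
  unfolding H_sub_def L2_ominus_def complex_span_def by fastforce

lemma H_sub_scale: "f \<in> H_sub M j \<Longrightarrow> (\<lambda>t. c * f t) \<in> H_sub M j"
  by (auto simp: H_sub_def L2_ominus_def L2_scale L2_inner_scale)

lemma H_sub_add:
  assumes "f \<in> H_sub M j" "g \<in> H_sub M j" "j \<le> p + 1"
  shows "(\<lambda>t. f t + g t) \<in> H_sub M j"
  by (rule H_subI)
    (use assms H_sub_L2 H_sub_orthogonal_E E_L2 in \<open>auto simp: L2_add L2_inner_add\<close>)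

lemma H_sub_diff:
  assumes "f \<in> H_sub M j" "g \<in> H_sub M j" "j \<le> p + 1"
  shows "(\<lambda>t. f t - g t) \<in> H_sub M j"
  using H_sub_add[OF assms(1) H_sub_scale[OF assms(2), of "-1"] assms(3)] by simp

lemma E_in_H_sub: "j \<le> p \<Longrightarrow> E j \<in> H_sub M j"
  by (rule H_subI) (auto simp: E_L2 L2_inner_E)

lemma H_sub_eq_0_AE:
  assumes "f \<in> H_sub M j" "\<And>h. h \<in> H_sub M j \<Longrightarrow> L2_inner M f h = 0"
  shows "AE t in M. f t = 0"
  using assms(2)[OF assms(1)] L2_norm_eq_0_AE[OF H_sub_L2[OF assms(1)]]
  by (simp add: L2_inner_self)

section \<open>Orthogonal projections onto the subspaces\<close>

text \<open>A concrete projection: it witnesses existence for the \<open>SOME\<close> in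
  \<open>L2_proj\<close>, and it is defined pointwise, which the density argument needs.\<close>

definition proj :: "nat \<Rightarrow> (real \<Rightarrow> complex) \<Rightarrow> real \<Rightarrow> complex" where
  "proj j f = (\<lambda>t. f t - (\<Sum>i<j. L2_inner M f (E i) * E i t))"

lemma proj_sum_L2: "j \<le> p + 1 \<Longrightarrow> (\<lambda>t. \<Sum>i<j. c i * E i t) \<in> L2 M"
  by (intro L2_sum L2_scale E_L2) auto

lemma proj_in_H_sub:
  assumes "f \<in> L2 M" "j \<le> p + 1"
  shows "proj j f \<in> H_sub M j"
proof (rule H_subI)
  show "proj j f \<in> L2 M"
    unfolding proj_def by (intro L2_diff assms proj_sum_L2)
  fix l assume l: "l < j"
  have "L2_inner M (\<lambda>t. \<Sum>i<j. L2_inner M f (E i) * E i t) (E l)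
      = (\<Sum>i<j. L2_inner M f (E i) * L2_inner M (E i) (E l))"
    using l assms(2) E_L2 by (subst L2_inner_sum) (auto intro: L2_scale simp: L2_inner_scale)
  also have "\<dots> = (\<Sum>i<j. if i = l then L2_inner M f (E i) else 0)"
    using l assms(2) by (intro sum.cong refl) (auto simp: L2_inner_E)
  also have "\<dots> = L2_inner M f (E l)" using l by simp
  finally show "L2_inner M (proj j f) (E l) = 0"
    unfolding proj_def using l assms E_L2 proj_sum_L2[of j] by (subst L2_inner_diff) auto
qed fact

lemma proj_orthogonal:
  assumes "f \<in> L2 M" "j \<le> p + 1" "h \<in> H_sub M j"
  shows "L2_inner M (proj j f) h = L2_inner M f h"
proof -
  have "L2_inner M (\<lambda>t. \<Sum>i<j. L2_inner M f (E i) * E i t) h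
      = (\<Sum>i<j. L2_inner M f (E i) * L2_inner M (E i) h)"
    using assms E_L2 H_sub_L2 by (subst L2_inner_sum) (auto intro: L2_scale simp: L2_inner_scale)
  also have "\<dots> = 0"
    using H_sub_orthogonal_E[OF assms(3,2)] L2_inner_cnj[of M _ h] by (intro sum.neutral) simp
  finally show ?thesis
    unfolding proj_def using assms H_sub_L2 proj_sum_L2[of j] by (subst L2_inner_diff) auto
qed

text \<open>(f, Pf) = ||Pf||^2, and the Young bound with \<epsilon> = 1 turns this into 2 ||Pf||^2
  \<le> ||f||^2 + ||Pf||^2.\<close>

lemma L2_norm_proj_le:
  assumes "f \<in> L2 M" "j \<le> p + 1"
  shows "L2_norm M (proj j f) \<le> L2_norm M f"
proof -
  note P = proj_in_H_sub[OF assms]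
  have "L2_inner M f (proj j f) = of_real ((L2_norm M (proj j f))\<^sup>2)"
    using proj_orthogonal[OF assms P] by (simp add: L2_inner_self)
  then have "(L2_norm M (proj j f))\<^sup>2 \<le> (L2_norm M f)\<^sup>2"
    using L2_inner_Young[OF assms(1) H_sub_L2[OF P], of 1] by (simp add: norm_power)
  then show ?thesis
    using L2_norm_nonneg power2_le_imp_le by blast
qed

lemma L2_proj_H_sub:
  assumes "f \<in> L2 M" "j \<le> p + 1"
  shows "L2_proj M (H_sub M j) f \<in> H_sub M j"
    and "h \<in> H_sub M j \<Longrightarrow> L2_inner M (L2_proj M (H_sub M j) f) h = L2_inner M f h"
proof -
  have "proj j f \<in> H_sub M j \<and> (\<forall>h\<in>H_sub M j. L2_inner M (\<lambda>t. f t - proj j f t) h = 0)"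
    using proj_in_H_sub[OF assms] proj_orthogonal[OF assms] assms H_sub_L2
    by (auto simp: L2_inner_diff)
  from someI[of "\<lambda>g. g \<in> H_sub M j \<and> (\<forall>h\<in>H_sub M j. L2_inner M (\<lambda>t. f t - g t) h = 0)", OF this]
  have *: "L2_proj M (H_sub M j) f \<in> H_sub M j"
      "\<forall>h\<in>H_sub M j. L2_inner M (\<lambda>t. f t - L2_proj M (H_sub M j) f t) h = 0"
    unfolding L2_proj_def by auto
  then show "L2_proj M (H_sub M j) f \<in> H_sub M j" by simp
  show "L2_inner M (L2_proj M (H_sub M j) f) h = L2_inner M f h" if "h \<in> H_sub M j"
    using * that assms(1) H_sub_L2 by (auto simp: L2_inner_diff)
qed

lemma L2_proj_AE:
  assumes "f \<in> L2 M" "j \<le> p + 1" "g \<in> H_sub M j"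
    and "\<And>h. h \<in> H_sub M j \<Longrightarrow> L2_inner M f h = L2_inner M g h"
  shows "AE t in M. L2_proj M (H_sub M j) f t = g t"
proof -
  note P = L2_proj_H_sub[OF assms(1,2)]
  have "AE t in M. L2_proj M (H_sub M j) f t - g t = 0"
    by (rule H_sub_eq_0_AE[OF H_sub_diff[OF P(1) assms(3,2)]])
      (use P assms H_sub_L2 in \<open>auto simp: L2_inner_diff\<close>)
  then show ?thesis by simp
qed

section \<open>The compressed operators and the weak form of their resolvent equations\<close>

lemma A_dom_D:
  assumes "f \<in> A_dom M j"
  shows "f \<in> L2 M" "f \<in> H_sub M j" "mult_op f \<in> L2 M"
  using assms by (auto simp: A_dom_def mult_dom_def mult_op_def)

lemma A_domI: "f \<in> H_sub M j \<Longrightarrow> mult_op f \<in> L2 M \<Longrightarrow> f \<in> A_dom M j"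
  by (auto simp: A_dom_def mult_dom_def mult_op_def H_sub_L2)

lemma A_dom_add_scale:
  assumes "f \<in> A_dom M j" "g \<in> A_dom M j" "j \<le> p + 1"
  shows "(\<lambda>t. f t + c * g t) \<in> A_dom M j"
proof (rule A_domI)
  show "(\<lambda>t. f t + c * g t) \<in> H_sub M j"
    using assms by (intro H_sub_add H_sub_scale A_dom_D)
  have "mult_op (\<lambda>t. f t + c * g t) = (\<lambda>t. mult_op f t + c * mult_op g t)"
    by (simp add: mult_op_def algebra_simps)
  then show "mult_op (\<lambda>t. f t + c * g t) \<in> L2 M"
    using assms by (simp add: L2_add L2_scale A_dom_D)
qed

lemma A_op_H_sub: "f \<in> A_dom M j \<Longrightarrow> j \<le> p + 1 \<Longrightarrow> A_op M j f \<in> H_sub M j"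
  unfolding A_op_def by (intro L2_proj_H_sub A_dom_D)

lemma L2_inner_A_op:
  "f \<in> A_dom M j \<Longrightarrow> j \<le> p + 1 \<Longrightarrow> h \<in> H_sub M j \<Longrightarrow> L2_inner M (A_op M j f) h = L2_inner M (mult_op f) h"
  unfolding A_op_def by (rule L2_proj_H_sub(2)[OF A_dom_D(3)])

text \<open>Weak form of \<open>(A\<^sub>j - z) f = P v\<close>, with \<open>P\<close> the projection onto \<open>H_sub M j\<close>.\<close>

definition weak_sol :: "nat \<Rightarrow> complex \<Rightarrow> (real \<Rightarrow> complex) \<Rightarrow> (real \<Rightarrow> complex) \<Rightarrow> bool" where
  "weak_sol j z v f \<longleftrightarrow> f \<in> A_dom M j \<and>
     (\<forall>h\<in>H_sub M j. L2_inner M (mult_op f) h = z * L2_inner M f h + L2_inner M v h)"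

lemma weak_solD:
  assumes "weak_sol j z v f"
  shows "f \<in> A_dom M j"
    and "h \<in> H_sub M j \<Longrightarrow> L2_inner M (mult_op f) h = z * L2_inner M f h + L2_inner M v h"
  using assms by (auto simp: weak_sol_def)

text \<open>The defect \<open>w\<close> of the strong equation lies in H_j, so it vanishes almost
  everywhere as soon as all test functions in H_j annihilate it.\<close>

lemma weak_sol_iff:
  assumes "f \<in> A_dom M j" "v \<in> H_sub M j" "j \<le> p + 1"
  shows "weak_sol j z v f \<longleftrightarrow> (AE t in M. A_op M j f t - z * f t = v t)"
proof
  note f = A_dom_D[OF assms(1)] and Af = A_op_H_sub[OF assms(1,3)] and v = H_sub_L2[OF assms(2)]
  define w where "w = (\<lambda>t. A_op M j f t - z * f t - v t)"
  have w: "w \<in> H_sub M j"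
    unfolding w_def by (intro H_sub_diff H_sub_scale Af f assms)
  have ip: "L2_inner M w h = L2_inner M (mult_op f) h - z * L2_inner M f h - L2_inner M v h"
    if "h \<in> H_sub M j" for h
    unfolding w_def using f Af v assms H_sub_L2[OF Af] H_sub_L2[OF that] L2_inner_A_op[OF assms(1,3) that]
    by (simp add: L2_inner_diff L2_diff L2_scale L2_inner_scale)
  {
    assume "weak_sol j z v f"
    then have "L2_inner M w h = 0" if "h \<in> H_sub M j" for h
      using ip[OF that] weak_solD(2) that by simp
    from H_sub_eq_0_AE[OF w this] show "AE t in M. A_op M j f t - z * f t = v t"
      by (simp add: w_def)
  }
  {
    assume "AE t in M. A_op M j f t - z * f t = v t"
    then have "AE t in M. w t = 0" by (simp add: w_def)
    then have "L2_inner M w h = 0" if "h \<in> H_sub M j" for h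
      using L2_inner_cong_AE[OF H_sub_L2[OF w] L2_zero H_sub_L2[OF that]] by (simp add: L2_inner_zero)
    then show "weak_sol j z v f"
      unfolding weak_sol_def using ip assms(1) by (auto simp: algebra_simps)
  }
qed

lemma weak_sol_add_scale:
  assumes "weak_sol j z v f" "weak_sol j z v' f'" "v \<in> L2 M" "v' \<in> L2 M" "j \<le> p + 1"
  shows "weak_sol j z (\<lambda>t. v t + c * v' t) (\<lambda>t. f t + c * f' t)"
proof -
  note f = weak_solD(1)[OF assms(1)] and f' = weak_solD(1)[OF assms(2)]
  have m: "mult_op (\<lambda>t. f t + c * f' t) = (\<lambda>t. mult_op f t + c * mult_op f' t)"
    by (simp add: mult_op_def algebra_simps)
  show ?thesis
    unfolding weak_sol_def m
    using A_dom_add_scale[OF f f' assms(5)] weak_solD(2)[OF assms(1)] weak_solD(2)[OF assms(2)]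
      A_dom_D[OF f] A_dom_D[OF f'] assms(3,4) H_sub_L2
    by (auto simp: L2_inner_add L2_scale L2_inner_scale algebra_simps)
qed

lemma weak_sol_cong_AE:
  assumes "weak_sol j z v f" "v \<in> L2 M" "v' \<in> L2 M" "AE t in M. v t = v' t"
  shows "weak_sol j z v' f"
  using assms L2_inner_cong_AE[OF assms(2,3) H_sub_L2 assms(4)] by (auto simp: weak_sol_def)

text \<open>Test with h = f: since (tf, f) is real, only z ||f||^2 and (v, f) have imaginary parts.
  The resolvent bound, uniqueness and the positivity of Im m_j all rest on this identity.\<close>

lemma weak_sol_Im:
  assumes "weak_sol j z v f"
  shows "Im (L2_inner M f v) = Im z * (L2_norm M f)\<^sup>2"
proof -
  have "Im (L2_inner M (mult_op f) f) = 0"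
    using L2_inner_cnj[of M "mult_op f" f] by (simp add: L2_inner_mult_op complex_eq_iff)
  moreover have "L2_inner M (mult_op f) f = z * of_real ((L2_norm M f)\<^sup>2) + L2_inner M v f"
    using weak_solD(2)[OF assms] A_dom_D(2)[OF weak_solD(1)[OF assms]] by (simp add: L2_inner_self)
  ultimately show ?thesis
    using L2_inner_cnj[of M f v] by simp
qed

lemma weak_sol_norm:
  assumes "weak_sol j z v f" "v \<in> L2 M" "z \<notin> \<real>"
  shows "(L2_norm M f)\<^sup>2 \<le> (L2_norm M v)\<^sup>2 / (Im z)\<^sup>2"
proof -
  have y: "\<bar>Im z\<bar> > 0" using assms(3) by (simp add: complex_is_Real_iff)
  have "2 * (\<bar>Im z\<bar> * (L2_norm M f)\<^sup>2) = 2 * \<bar>Im (L2_inner M f v)\<bar>"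
    by (simp add: weak_sol_Im[OF assms(1)] abs_mult)
  also have "\<dots> \<le> 2 * cmod (L2_inner M f v)" using abs_Im_le_cmod by simp
  also have "\<dots> \<le> \<bar>Im z\<bar> * (L2_norm M f)\<^sup>2 + (L2_norm M v)\<^sup>2 / \<bar>Im z\<bar>"
    using A_dom_D(1)[OF weak_solD(1)[OF assms(1)]] assms(2) y by (rule L2_inner_Young)
  finally have "(L2_norm M f)\<^sup>2 * \<bar>Im z\<bar> \<le> (L2_norm M v)\<^sup>2 / \<bar>Im z\<bar>" by (simp add: mult.commute)
  then have "(L2_norm M f)\<^sup>2 \<le> (L2_norm M v)\<^sup>2 / \<bar>Im z\<bar> / \<bar>Im z\<bar>"
    using y by (simp only: pos_le_divide_eq)
  then show ?thesis by (simp add: power2_eq_square)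
qed

text \<open>The decay like 1/|Im z| is what controls the remainder in the expansion of m_j.\<close>

lemma weak_sol_inner_bound:
  assumes "weak_sol j z v f" "v \<in> L2 M" "z \<notin> \<real>"
  shows "cmod (L2_inner M f v) \<le> (L2_norm M v)\<^sup>2 / \<bar>Im z\<bar>"
proof -
  have y: "\<bar>Im z\<bar> > 0" using assms(3) by (simp add: complex_is_Real_iff)
  have "2 * cmod (L2_inner M f v) \<le> \<bar>Im z\<bar> * (L2_norm M f)\<^sup>2 + (L2_norm M v)\<^sup>2 / \<bar>Im z\<bar>"
    using A_dom_D(1)[OF weak_solD(1)[OF assms(1)]] assms(2) y by (rule L2_inner_Young)
  also have "\<bar>Im z\<bar> * (L2_norm M f)\<^sup>2 \<le> \<bar>Im z\<bar> * ((L2_norm M v)\<^sup>2 / (Im z)\<^sup>2)"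
    using y by (intro mult_left_mono weak_sol_norm[OF assms]) auto
  also have "\<dots> = (L2_norm M v)\<^sup>2 / \<bar>Im z\<bar>"
    using y by (simp add: power2_eq_square divide_simps)
  finally show ?thesis by simp
qed

lemma weak_sol_unique:
  assumes "weak_sol j z v f" "weak_sol j z v f'" "v \<in> L2 M" "z \<notin> \<real>" "j \<le> p + 1"
  shows "AE t in M. f t = f' t"
proof -
  have s: "weak_sol j z (\<lambda>t. v t + (-1) * v t) (\<lambda>t. f t + (-1) * f' t)"
    by (rule weak_sol_add_scale[OF assms(1,2,3,3,5)])
  then have s: "weak_sol j z (\<lambda>t. 0) (\<lambda>t. f t + (-1) * f' t)" by simp
  have "(L2_norm M (\<lambda>t. f t + (-1) * f' t))\<^sup>2 \<le> 0"
    using weak_sol_norm[OF s L2_zero assms(4)] by (simp add: L2_norm_def)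
  then have "AE t in M. f t + (-1) * f' t = 0"
    by (intro L2_norm_eq_0_AE A_dom_D(1)[OF weak_solD(1)[OF s]]) simp
  then show ?thesis by simp
qed

text \<open>Here the subspace is everything and the resolvent is explicit; t f = z f + v shows that
  f lies in the domain.\<close>

lemma weak_sol_0:
  assumes "v \<in> L2 M" "z \<notin> \<real>"
  shows "weak_sol 0 z v (\<lambda>t. v t / (of_real t - z))"
proof -
  let ?f = "\<lambda>t. v t / (of_real t - z)"
  have meas: "?f \<in> borel_measurable M"
    using borel_measurable_times[OF L2_D(1)[OF assms(1)] resolvent_kernel_measurable[OF borel, of z]] by simp
  have int: "integrable M (\<lambda>t. (cmod (?f t))\<^sup>2)"
  proof (rule Bochner_Integration.integrable_bound)
    show "integrable M (\<lambda>t. (cmod (v t))\<^sup>2 * (1 / \<bar>Im z\<bar>)\<^sup>2)"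
      using L2_D(2)[OF assms(1)] by (intro integrable_mult_left)
    show "(\<lambda>t. (cmod (?f t))\<^sup>2) \<in> borel_measurable M"
      using meas by measurable
    have "(cmod (?f t))\<^sup>2 \<le> (cmod (v t))\<^sup>2 * (1 / \<bar>Im z\<bar>)\<^sup>2" for t
      using mult_left_mono[OF power_mono[OF cmod_resolvent_kernel_le[OF assms(2), of t] norm_ge_zero, of 2], of "(cmod (v t))\<^sup>2"]
      by (simp add: norm_divide power_divide)
    then show "AE t in M. norm ((cmod (?f t))\<^sup>2) \<le> norm ((cmod (v t))\<^sup>2 * (1 / \<bar>Im z\<bar>)\<^sup>2)"
      by (intro AE_I2) simp
  qed
  have f: "?f \<in> L2 M" using meas int by (simp add: L2_def)
  have m: "mult_op ?f = (\<lambda>t. z * ?f t + v t)"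
    using nonreal_not_of_real[OF assms(2)] by (simp add: mult_op_def fun_eq_iff field_simps)
  have "mult_op ?f \<in> L2 M" unfolding m by (intro L2_add L2_scale f assms)
  then have "?f \<in> A_dom M 0" using f by (intro A_domI) (simp add: H_sub_0)
  moreover have "L2_inner M (mult_op ?f) h = z * L2_inner M ?f h + L2_inner M v h" if "h \<in> H_sub M 0" for h
    unfolding m L2_inner_add[OF L2_scale[OF f] assms(1) H_sub_L2[OF that]] L2_inner_scale ..
  ultimately show ?thesis by (simp add: weak_sol_def)
qed

text \<open>If g were null, testing with e_j would give 0 = 1; then Im (g, e_j) = Im z ||g||^2 is
  nonzero. This licenses every later division by m_j.\<close>

lemma weak_sol_E_nonzero:
  assumes "weak_sol j z (E j) g" "z \<notin> \<real>" "j \<le> p"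
  shows "L2_norm M g \<noteq> 0" "L2_inner M g (E j) \<noteq> 0"
proof -
  note g = A_dom_D[OF weak_solD(1)[OF assms(1)]]
  show n: "L2_norm M g \<noteq> 0"
  proof
    assume "L2_norm M g = 0"
    then have ae: "AE t in M. g t = 0" by (rule L2_norm_eq_0_AE[OF g(1)])
    then have "AE t in M. mult_op g t = 0" by eventually_elim (simp add: mult_op_def)
    from L2_inner_cong_AE[OF g(3) L2_zero E_L2[OF assms(3)] this]
      L2_inner_cong_AE[OF g(1) L2_zero E_L2[OF assms(3)] ae]
      weak_solD(2)[OF assms(1) E_in_H_sub[OF assms(3)]]
    show False using assms(3) by (simp add: L2_inner_zero L2_inner_E)
  qed
  have "Im (L2_inner M g (E j)) \<noteq> 0"
    using weak_sol_Im[OF assms(1)] n assms(2) by (simp add: complex_is_Real_iff)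
  then show "L2_inner M g (E j) \<noteq> 0" by auto
qed

text \<open>Test functions in H_(j+1) are orthogonal to e_j, so on that level the right-hand sides v
  and v + c e_j are indistinguishable. The freedom in c is spent on pushing the level-j solution
  into H_(j+1). The induction hypothesis is applied both to v and to e_j, hence v is
  arbitrary.\<close>

lemma weak_sol_exists:
  assumes "z \<notin> \<real>" "j \<le> p" "v \<in> L2 M"
  shows "\<exists>f. weak_sol j z v f"
  using assms(2,3)
proof (induction j arbitrary: v)
  case 0
  then show ?case using weak_sol_0[OF _ assms(1)] by blast
next
  case (Suc j)
  then have j: "j \<le> p" "j \<le> p + 1" by auto
  obtain f where f: "weak_sol j z v f" using Suc.IH[OF j(1)] Suc.prems by blast
  obtain g where g: "weak_sol j z (E j) g" using Suc.IH[OF j(1) E_L2[OF j(1)]] by blast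
  note g0 = weak_sol_E_nonzero(2)[OF g assms(1) j(1)]
  \<comment> \<open>Chosen so that f + c g is orthogonal to e_j.\<close>
  define c where "c = - L2_inner M f (E j) / L2_inner M g (E j)"
  let ?h = "\<lambda>t. f t + c * g t"
  have s: "weak_sol j z (\<lambda>t. v t + c * E j t) ?h"
    by (rule weak_sol_add_scale[OF f g Suc.prems(2) E_L2[OF j(1)] j(2)])
  note h = A_dom_D[OF weak_solD(1)[OF s]]
  have "L2_inner M ?h (E j) = L2_inner M f (E j) + c * L2_inner M g (E j)"
    using A_dom_D[OF weak_solD(1)[OF f]] A_dom_D[OF weak_solD(1)[OF g]] E_L2[OF j(1)]
    by (simp add: L2_inner_add L2_scale L2_inner_scale)
  then have "L2_inner M ?h (E j) = 0"
    using g0 by (simp add: c_def)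
  then have "?h \<in> H_sub M (Suc j)"
    using h Suc.prems H_sub_orthogonal_E[OF h(2) j(2)] by (intro H_subI) (auto simp: less_Suc_eq)
  then have "?h \<in> A_dom M (Suc j)" using h by (intro A_domI)
  moreover have "L2_inner M (mult_op ?h) k = z * L2_inner M ?h k + L2_inner M v k" if k: "k \<in> H_sub M (Suc j)" for k
  proof -
    have "L2_inner M (E j) k = 0"
      using H_sub_orthogonal_E[OF k, of j] Suc.prems L2_inner_cnj[of M "E j" k] by simp
    then have vk: "L2_inner M (\<lambda>t. v t + c * E j t) k = L2_inner M v k"
      using Suc.prems E_L2[OF j(1)] H_sub_L2[OF k] by (simp add: L2_inner_add L2_scale L2_inner_scale)
    show ?thesis
      using weak_solD(2)[OF s subsetD[OF H_sub_Suc_subset k]] unfolding vk .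
  qed
  ultimately show ?case unfolding weak_sol_def by blast
qed

subsection \<open>Self-adjointness and resolvents\<close>

lemma of_real_measurable: "(\<lambda>t. complex_of_real t) \<in> borel_measurable M"
  by (subst measurable_cong_sets[OF borel refl]) measurable

lemma mult_op_measurable: "f \<in> borel_measurable M \<Longrightarrow> mult_op f \<in> borel_measurable M"
  unfolding mult_op_def by (intro borel_measurable_times of_real_measurable)

lemma mult_op_E_L2: "j < p \<Longrightarrow> mult_op (E j) \<in> L2 M"
  unfolding mult_op_cpoly using degree_e[of j] by (intro cpoly_L2) simp

lemma E_in_A_dom: "j < p \<Longrightarrow> E j \<in> A_dom M j"
  by (intro A_domI E_in_H_sub mult_op_E_L2) simp_all

lemma truncation_in_mult_dom:
  assumes "f \<in> L2 M" "0 \<le> r"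
  shows "(\<lambda>t. indicator {-r..r} t * f t) \<in> L2 M" "mult_op (\<lambda>t. indicator {-r..r} t * f t) \<in> L2 M"
proof -
  let ?g = "\<lambda>t. indicator {-r..r} t * f t"
  have ind: "(\<lambda>t. indicator {-r..r} t :: complex) \<in> borel_measurable M"
    by (subst measurable_cong_sets[OF borel refl]) measurable
  have meas: "?g \<in> borel_measurable M"
    by (intro borel_measurable_times ind L2_D(1)[OF assms(1)])
  have "integrable M (\<lambda>t. (cmod (?g t))\<^sup>2)"
    by (rule Bochner_Integration.integrable_bound[OF L2_D(2)[OF assms(1)]])
      (use meas in \<open>auto split: split_indicator\<close>)
  then show "?g \<in> L2 M" using meas by (simp add: L2_def)
  have bound: "(cmod (mult_op ?g t))\<^sup>2 \<le> r\<^sup>2 * (cmod (f t))\<^sup>2" for t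
  proof (cases "t \<in> {-r..r}")
    case True
    then have "t\<^sup>2 \<le> r\<^sup>2" using assms(2) by (auto intro!: abs_le_square_iff[THEN iffD1])
    then show ?thesis
      using True by (simp add: mult_op_def norm_mult power_mult_distrib mult_right_mono)
  qed (simp add: mult_op_def)
  have "integrable M (\<lambda>t. (cmod (mult_op ?g t))\<^sup>2)"
    by (rule Bochner_Integration.integrable_bound[OF integrable_mult_right[OF L2_D(2)[OF assms(1)], of "r\<^sup>2"]])
      (use mult_op_measurable[OF meas] bound in auto)
  then show "mult_op ?g \<in> L2 M"
    using mult_op_measurable[OF meas] by (simp add: L2_def)
qed

lemma truncation_LIMSEQ:
  assumes "f \<in> L2 M"
  shows "(\<lambda>m. L2_norm M (\<lambda>t. f t - indicator {-real m..real m} t * f t)) \<longlonglongrightarrow> 0"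
proof -
  let ?g = "\<lambda>m t. (cmod (f t - indicator {-real m..real m} t * f t))\<^sup>2"
  have meas: "?g m \<in> borel_measurable M" for m
    using truncation_in_mult_dom(1)[OF assms, of "real m"] assms L2_D(2)[OF L2_diff]
    by (intro borel_measurable_integrable) auto
  have "(\<lambda>m. LINT t|M. ?g m t) \<longlonglongrightarrow> (LINT t|M. 0)"
  proof (rule integral_dominated_convergence[OF _ meas L2_D(2)[OF assms]])
    show "AE t in M. (\<lambda>m. ?g m t) \<longlonglongrightarrow> 0"
    proof (rule AE_I2)
      fix t :: real
      have "eventually (\<lambda>m. ?g m t = 0) sequentially"
        using eventually_ge_at_top[of "nat \<lceil>\<bar>t\<bar>\<rceil>"]
      proof eventually_elim
        case (elim m)
        then have "\<bar>t\<bar> \<le> real m" by linarith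
        then show ?case by (simp add: indicator_def abs_le_iff)
      qed
      then show "(\<lambda>m. ?g m t) \<longlonglongrightarrow> 0" by (rule tendsto_eventually)
    qed
    show "AE t in M. norm (?g m t) \<le> (cmod (f t))\<^sup>2" for m
      by (intro AE_I2) (simp split: split_indicator)
  qed simp
  then have "(\<lambda>m. LINT t|M. ?g m t) \<longlonglongrightarrow> 0" by simp
  from tendsto_real_sqrt[OF this] show ?thesis by (simp add: L2_norm_def)
qed

text \<open>Cutting f off to a bounded interval reaches the domain of multiplication but leaves H_j.
  Projecting back subtracts multiples of e_i with i < j \<le> p, for which t e_i is
  square-integrable, so the domain is kept; as P fixes f and is a contraction, the error does not
  grow.\<close>

lemma A_dom_dense:
  assumes "j \<le> p"
  shows "L2_dense M (H_sub M j) (A_dom M j)"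
  unfolding L2_dense_def
proof (intro ballI allI impI)
  fix f and \<epsilon> :: real
  assume f: "f \<in> H_sub M j" and "\<epsilon> > 0"
  have j: "j \<le> p + 1" using assms by simp
  note f2 = H_sub_L2[OF f]
  obtain m where m: "L2_norm M (\<lambda>t. f t - indicator {-real m..real m} t * f t) < \<epsilon>"
    using order_tendstoD(2)[OF truncation_LIMSEQ[OF f2] \<open>\<epsilon> > 0\<close>] eventually_happens'[OF sequentially_bot]
    by blast
  define g where "g = (\<lambda>t. indicator {-real m..real m} t * f t)"
  have m': "L2_norm M (\<lambda>t. f t - g t) < \<epsilon>" using m by (simp add: g_def)
  have g: "g \<in> L2 M" "mult_op g \<in> L2 M"
    unfolding g_def using truncation_in_mult_dom[OF f2, of "real m"] by auto
  have "mult_op (proj j g) = (\<lambda>t. mult_op g t - (\<Sum>i<j. L2_inner M g (E i) * mult_op (E i) t))"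
    by (simp add: mult_op_def proj_def fun_eq_iff algebra_simps sum_distrib_left)
  also have "\<dots> \<in> L2 M"
    using assms by (intro L2_diff g L2_sum L2_scale mult_op_E_L2) auto
  finally have "proj j g \<in> A_dom M j"
    by (intro A_domI proj_in_H_sub g j)
  moreover have "(\<lambda>t. f t - proj j g t) = proj j (\<lambda>t. f t - g t)"
  proof -
    have "L2_inner M (\<lambda>t. f t - g t) (E i) = - L2_inner M g (E i)" if "i < j" for i
      using that assms f2 g E_L2 H_sub_orthogonal_E[OF f j that] by (subst L2_inner_diff) auto
    then show ?thesis by (simp add: proj_def fun_eq_iff sum_negf)
  qed
  ultimately show "\<exists>g\<in>A_dom M j. L2_norm M (\<lambda>t. f t - g t) < \<epsilon>"
    using L2_norm_proj_le[OF L2_diff[OF f2 g(1)] j] m'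
    by (intro bexI[of _ "proj j g"]) auto
qed

lemma op_graph_subset_adjoint:
  assumes "j \<le> p"
  shows "op_graph M (H_sub M j) (A_dom M j) (A_op M j) \<subseteq> adjoint_graph M (H_sub M j) (A_dom M j) (A_op M j)"
proof -
  have j: "j \<le> p + 1" using assms by simp
  have "L2_inner M (A_op M j f) g = L2_inner M f h"
    if g: "g \<in> A_dom M j" and h: "h \<in> H_sub M j" and ae: "AE t in M. h t = A_op M j g t" and f: "f \<in> A_dom M j"
    for f g h
  proof -
    have "L2_inner M (A_op M j f) g = L2_inner M (mult_op f) g"
      by (rule L2_inner_A_op[OF f j A_dom_D(2)[OF g]])
    also have "\<dots> = cnj (L2_inner M (mult_op g) f)"
      by (rule L2_inner_mult_op_cnj)
    also have "\<dots> = cnj (L2_inner M (A_op M j g) f)"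
      using L2_inner_A_op[OF g j A_dom_D(2)[OF f]] by simp
    also have "\<dots> = cnj (L2_inner M h f)"
      using L2_inner_cong_AE[OF H_sub_L2[OF h] H_sub_L2[OF A_op_H_sub[OF g j]] A_dom_D(1)[OF f] ae] by simp
    also have "\<dots> = L2_inner M f h" by (rule L2_inner_cnj[symmetric])
    finally show ?thesis .
  qed
  then show ?thesis
    unfolding op_graph_def adjoint_graph_def using A_dom_D by auto
qed

text \<open>Range criterion: for (g, h) in the adjoint graph solve (A_j - i) g1 = h - i g. Then d =
  g - g1 is orthogonal to the range of A_j + i; that range contains d itself, so d = 0.\<close>

lemma adjoint_subset_op_graph:
  assumes "j \<le> p"
  shows "adjoint_graph M (H_sub M j) (A_dom M j) (A_op M j) \<subseteq> op_graph M (H_sub M j) (A_dom M j) (A_op M j)"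
proof -
  have j: "j \<le> p + 1" using assms by simp
  have nr: "\<i> \<notin> \<real>" "-\<i> \<notin> \<real>" by (simp_all add: complex_is_Real_iff)
  have "g \<in> A_dom M j \<and> (AE t in M. h t = A_op M j g t)"
    if g: "g \<in> H_sub M j" and h: "h \<in> H_sub M j"
      and adj: "\<And>f. f \<in> A_dom M j \<Longrightarrow> L2_inner M (A_op M j f) g = L2_inner M f h" for g h
  proof -
    note g2 = H_sub_L2[OF g] and h2 = H_sub_L2[OF h]
    have w2: "(\<lambda>t. h t - \<i> * g t) \<in> L2 M" by (intro L2_diff L2_scale g2 h2)
    obtain g1 where g1: "weak_sol j \<i> (\<lambda>t. h t - \<i> * g t) g1"
      using weak_sol_exists[OF nr(1) assms w2] by blast
    note G = weak_solD(1)[OF g1] and G1 = A_dom_D[OF weak_solD(1)[OF g1]]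
    define d where "d = (\<lambda>t. g t - g1 t)"
    have d: "d \<in> H_sub M j" unfolding d_def by (intro H_sub_diff g G1 j)
    note d2 = H_sub_L2[OF d]
    have *: "L2_inner M (mult_op f) d = - \<i> * L2_inner M f d" if f: "f \<in> A_dom M j" for f
    proof -
      note F = A_dom_D[OF f]
      have "L2_inner M (mult_op f) g = L2_inner M f h"
        using adj[OF f] L2_inner_A_op[OF f j g] by simp
      moreover have "L2_inner M (mult_op f) g1 = cnj (L2_inner M (mult_op g1) f)"
        by (rule L2_inner_mult_op_cnj)
      moreover have "L2_inner M (mult_op g1) f = \<i> * L2_inner M g1 f + (L2_inner M h f - \<i> * L2_inner M g f)"
        using weak_solD(2)[OF g1 F(2)] g2 h2 F(1) by (simp add: L2_inner_diff L2_scale L2_inner_scale)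
      ultimately show ?thesis
        unfolding d_def using g2 G1 F
        by (simp add: L2_inner_diff_right algebra_simps L2_inner_cnj[symmetric])
    qed
    obtain f where f: "weak_sol j (-\<i>) d f"
      using weak_sol_exists[OF nr(2) assms d2] by blast
    have "L2_inner M d d = 0"
      using weak_solD(2)[OF f d] *[OF weak_solD(1)[OF f]] by simp
    then have "AE t in M. d t = 0"
      by (intro L2_norm_eq_0_AE d2) (simp add: L2_inner_self)
    then have ae: "AE t in M. g1 t = g t" unfolding d_def by eventually_elim simp
    then have mae: "AE t in M. mult_op g1 t = mult_op g t"
      by eventually_elim (simp add: mult_op_def)
    \<comment> \<open>\<open>g\<close> agrees with \<open>g1\<close> only almost everywhere, so
      membership in the domain has to be carried across a null set.\<close>
    have mg: "mult_op g \<in> L2 M"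
      by (rule L2_cong_AE[OF G1(3) mult_op_measurable[OF L2_D(1)[OF g2]] mae])
    then have gD: "g \<in> A_dom M j" by (intro A_domI g)
    note Ag = A_op_H_sub[OF gD j]
    have "AE t in M. h t - A_op M j g t = 0"
    proof (rule H_sub_eq_0_AE[OF H_sub_diff[OF h Ag j]])
      fix k assume k: "k \<in> H_sub M j"
      note k2 = H_sub_L2[OF k]
      have "L2_inner M (A_op M j g) k = L2_inner M (mult_op g1) k"
        using L2_inner_A_op[OF gD j k] L2_inner_cong_AE[OF G1(3) mg k2 mae] by simp
      also have "\<dots> = \<i> * L2_inner M g1 k + (L2_inner M h k - \<i> * L2_inner M g k)"
        using weak_solD(2)[OF g1 k] g2 h2 k2 by (simp add: L2_inner_diff L2_scale L2_inner_scale)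
      also have "\<dots> = L2_inner M h k"
        using L2_inner_cong_AE[OF G1(1) g2 k2 ae] by simp
      finally show "L2_inner M (\<lambda>t. h t - A_op M j g t) k = 0"
        using h2 H_sub_L2[OF Ag] k2 by (simp add: L2_inner_diff)
    qed
    then show ?thesis using gD by simp
  qed
  then show ?thesis
    unfolding op_graph_def adjoint_graph_def by auto
qed

lemma self_adjoint_A:
  assumes "j \<le> p"
  shows "self_adjoint_in M (H_sub M j) (A_dom M j) (A_op M j)"
  unfolding self_adjoint_in_def
  using A_dom_D A_op_H_sub assms A_dom_dense[OF assms]
    op_graph_subset_adjoint[OF assms] adjoint_subset_op_graph[OF assms]
  by auto

lemma in_resolvent_set_A:
  assumes "j \<le> p" "z \<notin> \<real>"
  shows "in_resolvent_set M (H_sub M j) (A_dom M j) (A_op M j) z"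
  unfolding in_resolvent_set_def
proof (intro conjI ballI exI[of _ "1 / \<bar>Im z\<bar>"])
  have j: "j \<le> p + 1" using assms by simp
  show "\<exists>f\<in>A_dom M j. AE t in M. A_op M j f t - z * f t = v t" if v: "v \<in> H_sub M j" for v
    using weak_sol_exists[OF assms(2,1) H_sub_L2[OF v]] weak_sol_iff[OF _ v j] weak_solD(1) by blast
  fix f assume f: "f \<in> A_dom M j"
  let ?v = "\<lambda>t. A_op M j f t - z * f t"
  have v: "?v \<in> H_sub M j"
    by (intro H_sub_diff H_sub_scale A_op_H_sub A_dom_D(2) f j)
  have "weak_sol j z ?v f" using weak_sol_iff[OF f v j] by simp
  from weak_sol_norm[OF this H_sub_L2[OF v] assms(2)]
  have "(L2_norm M f)\<^sup>2 \<le> (1 / \<bar>Im z\<bar> * L2_norm M ?v)\<^sup>2"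
    by (simp add: power_divide)
  then show "L2_norm M f \<le> 1 / \<bar>Im z\<bar> * L2_norm M ?v"
    by (rule power2_le_imp_le) (simp add: L2_norm_nonneg)
qed

lemma weak_sol_resolvent:
  assumes "j \<le> p" "z \<notin> \<real>" "v \<in> H_sub M j"
  shows "weak_sol j z v (resolvent M (A_dom M j) (A_op M j) z v)"
proof -
  have j: "j \<le> p + 1" using assms by simp
  have "\<exists>f. f \<in> A_dom M j \<and> (AE t in M. A_op M j f t - z * f t = v t)"
    using in_resolvent_set_A[OF assms(1,2)] assms(3) unfolding in_resolvent_set_def by blast
  from someI_ex[OF this] show ?thesis
    unfolding resolvent_def using weak_sol_iff[OF _ assms(3) j] by blast
qed

subsection \<open>The Schur transform\<close>

text \<open>The function m_j: the diagonal resolvent entry at e_j of the truncated Jacobi operator.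
  The \<open>SOME\<close> is harmless because weak solutions are unique almost everywhere.\<close>

definition green :: "nat \<Rightarrow> complex \<Rightarrow> complex" where
  "green j z = L2_inner M (SOME g. weak_sol j z (E j) g) (E j)"

lemma green_witness:
  assumes "j \<le> p" "z \<notin> \<real>"
  obtains g where "weak_sol j z (E j) g" "green j z = L2_inner M g (E j)"
  using someI_ex[OF weak_sol_exists[OF assms(2,1) E_L2[OF assms(1)]]] unfolding green_def by blast

text \<open>Independence of the chosen solution, with a factor c because the solutions met later
  have right-hand sides b_j e_(j+1) or u_j rather than a unit vector.\<close>

lemma weak_sol_scaled_E:
  assumes "weak_sol j z (\<lambda>t. c * E j t) f" "j \<le> p" "z \<notin> \<real>"
  shows "L2_inner M f (E j) = c * green j z"
proof -
  note E2 = E_L2[OF assms(2)]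
  have j: "j \<le> p + 1" using assms(2) by simp
  obtain g where g: "weak_sol j z (E j) g" "green j z = L2_inner M g (E j)"
    by (rule green_witness[OF assms(2,3)])
  have zero: "weak_sol j z (\<lambda>t. 0) (\<lambda>t. 0)"
    using H_sub_scale[OF E_in_H_sub[OF assms(2)], of 0]
    by (auto simp: weak_sol_def A_dom_def mult_dom_def mult_op_def L2_zero L2_inner_zero)
  have "weak_sol j z (\<lambda>t. 0 + c * E j t) (\<lambda>t. 0 + c * g t)"
    by (rule weak_sol_add_scale[OF zero g(1) L2_zero E2 j])
  then have s: "weak_sol j z (\<lambda>t. c * E j t) (\<lambda>t. c * g t)" by simp
  have "L2_inner M f (E j) = L2_inner M (\<lambda>t. c * g t) (E j)"
    by (rule L2_inner_cong_AE[OF A_dom_D(1)[OF weak_solD(1)[OF assms(1)]]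
          A_dom_D(1)[OF weak_solD(1)[OF s]] E2 weak_sol_unique[OF assms(1) s L2_scale[OF E2] assms(3) j]])
  then show ?thesis by (simp add: L2_inner_scale g(2))
qed

lemma green_Im_pos:
  assumes "j \<le> p" "0 < Im z"
  shows "0 < Im (green j z)"
proof -
  have nr: "z \<notin> \<real>" using assms(2) by (auto simp: complex_is_Real_iff)
  obtain g where g: "weak_sol j z (E j) g" "green j z = L2_inner M g (E j)"
    by (rule green_witness[OF assms(1) nr])
  show ?thesis
    using weak_sol_E_nonzero(1)[OF g(1) nr assms(1)] assms(2)
    unfolding g(2) weak_sol_Im[OF g(1)] by simp
qed

lemma green_nonzero:
  assumes "j \<le> p" "z \<notin> \<real>"
  shows "green j z \<noteq> 0"
  using assms weak_sol_E_nonzero(2) green_witness by metis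

text \<open>Test the equation for g with g' and the one for g' with g; symmetry of multiplication
  equates the two values of (tg, g').\<close>

lemma green_cnj:
  assumes "j \<le> p" "z \<notin> \<real>"
  shows "green j (cnj z) = cnj (green j z)"
proof -
  have nr: "cnj z \<notin> \<real>" using assms(2) by (simp add: complex_is_Real_iff)
  obtain g where g: "weak_sol j z (E j) g" "green j z = L2_inner M g (E j)"
    by (rule green_witness[OF assms])
  obtain g' where g': "weak_sol j (cnj z) (E j) g'" "green j (cnj z) = L2_inner M g' (E j)"
    by (rule green_witness[OF assms(1) nr])
  have "L2_inner M (mult_op g) g' = z * L2_inner M g g' + L2_inner M (E j) g'"
    by (rule weak_solD(2)[OF g(1) A_dom_D(2)[OF weak_solD(1)[OF g'(1)]]])
  moreover have "L2_inner M (mult_op g') g = cnj z * L2_inner M g' g + L2_inner M (E j) g"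
    by (rule weak_solD(2)[OF g'(1) A_dom_D(2)[OF weak_solD(1)[OF g(1)]]])
  then have "L2_inner M (mult_op g) g' = z * L2_inner M g g' + L2_inner M g (E j)"
    using L2_inner_mult_op_cnj[of M g g'] L2_inner_cnj[of M g g'] L2_inner_cnj[of M g "E j"] by simp
  ultimately show ?thesis
    unfolding g(2) g'(2) using L2_inner_cnj[of M g' "E j"] by simp
qed

text \<open>By the recurrence, t e_j - b_j e_(j+1) has degree at most j and is invisible to
  H_(j+1).\<close>

lemma L2_inner_H_sub_mult_op_E:
  assumes "h \<in> H_sub M (Suc j)" "j < p"
  shows "L2_inner M (mult_op (E j)) h = of_real (jacobi_off j) * L2_inner M (E (Suc j)) h"
proof -
  let ?q = "[:0, 1:] * e j" and ?r = "Polynomial.smult (jacobi_off j) (e (Suc j))"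
  have "?q - ?r = (if j = 0 then 0 else Polynomial.smult (jacobi_off (j - 1)) (e (j - 1)))
      + Polynomial.smult (jacobi_diag j) (e j)"
    using three_term_recurrence_e[OF assms(2)] unfolding three_term_recurrence_def by simp
  then have "Polynomial.coeff (?q - ?r) n = 0" if "n \<ge> Suc j" for n
    using that assms(2) coeff_e_eq_0[of j n] coeff_e_eq_0[of "j - 1" n]
    by (simp only: coeff_add coeff_smult) auto
  then have "L2_inner M h (cpoly (?q - ?r)) = 0"
    using assms(2) by (intro H_sub_orthogonal[OF assms(1)]) auto
  moreover have "cpoly (?q - ?r) = (\<lambda>t. mult_op (E j) t - of_real (jacobi_off j) * E (Suc j) t)"
    by (simp add: cpoly_def mult_op_def)
  ultimately have "L2_inner M h (mult_op (E j)) = of_real (jacobi_off j) * L2_inner M h (E (Suc j))"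
    using assms(2) mult_op_E_L2[OF assms(2)] E_L2[of "Suc j"] H_sub_L2[OF assms(1)]
    by (simp add: L2_inner_diff_right L2_scale L2_inner_scale_right)
  then show ?thesis
    using L2_inner_cnj[of M "mult_op (E j)" h] L2_inner_cnj[of M "E (Suc j)" h] by simp
qed

lemma L2_inner_mult_op_E_E: "L2_inner M (mult_op (E j)) (E j) = of_real (jacobi_diag j)"
  by (simp only: mult_op_cpoly L2_inner_cpoly jacobi_diag_def)

text \<open>If \<open>g = (A\<^sub>j - z)\<inverse> e\<^sub>j\<close> and \<open>m = (g, e\<^sub>j)\<close>, then \<open>e\<^sub>j - g / m\<close> is orthogonal to \<open>e\<^sub>j\<close> and
  equals \<open>(A\<^sub>j\<^sub>+\<^sub>1 - z)\<inverse> (b\<^sub>j e\<^sub>j\<^sub>+\<^sub>1)\<close>.\<close>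

lemma green_Suc:
  assumes "j < p" "z \<notin> \<real>"
  shows "of_real ((jacobi_off j)\<^sup>2) * green (Suc j) z = of_real (jacobi_diag j) - z - 1 / green j z"
proof -
  have j: "j \<le> p" "j \<le> p + 1" "Suc j \<le> p" "Suc j \<le> p + 1" using assms by auto
  obtain g where g: "weak_sol j z (E j) g" "green j z = L2_inner M g (E j)"
    by (rule green_witness[OF j(1) assms(2)])
  define m where "m = green j z"
  have m0: "m \<noteq> 0" unfolding m_def by (rule green_nonzero[OF j(1) assms(2)])
  note G = A_dom_D[OF weak_solD(1)[OF g(1)]] and E2 = E_L2[OF j(1)] and tE = mult_op_E_L2[OF assms(1)]
  define f where "f = (\<lambda>t. E j t + (- 1 / m) * g t)"
  have fA: "f \<in> A_dom M j"
    unfolding f_def by (rule A_dom_add_scale[OF E_in_A_dom[OF assms(1)] weak_solD(1)[OF g(1)] j(2)])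
  note F = A_dom_D[OF fA]
  have fip: "L2_inner M f h = L2_inner M (E j) h - L2_inner M g h / m" if "h \<in> L2 M" for h
    unfolding f_def using E2 G that by (simp only: L2_inner_add L2_scale L2_inner_scale) simp
  have "mult_op f = (\<lambda>t. mult_op (E j) t + (- 1 / m) * mult_op g t)"
    by (simp add: f_def mult_op_def algebra_simps)
  then have mfip: "L2_inner M (mult_op f) h = L2_inner M (mult_op (E j)) h - L2_inner M (mult_op g) h / m"
    if "h \<in> L2 M" for h
    using tE G that by (simp only: L2_inner_add L2_scale L2_inner_scale) simp
  have fE: "L2_inner M f (E j) = 0"
    using fip[OF E2] m0 j by (simp add: L2_inner_E m_def g(2))
  have fH: "f \<in> H_sub M (Suc j)"
    using F H_sub_orthogonal_E[OF F(2) j(2)] fE j(4) by (intro H_subI) (auto simp: less_Suc_eq)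
  have "L2_inner M (mult_op f) h = z * L2_inner M f h + L2_inner M (\<lambda>t. of_real (jacobi_off j) * E (Suc j) t) h"
    if h: "h \<in> H_sub M (Suc j)" for h
  proof -
    have "L2_inner M (E j) h = 0"
      using H_sub_orthogonal_E[OF h j(4), of j] L2_inner_cnj[of M "E j" h] by simp
    then show ?thesis
      using mfip[OF H_sub_L2[OF h]] fip[OF H_sub_L2[OF h]] weak_solD(2)[OF g(1) subsetD[OF H_sub_Suc_subset h]]
        L2_inner_H_sub_mult_op_E[OF h assms(1)]
      by (simp add: L2_inner_scale)
  qed
  then have "weak_sol (Suc j) z (\<lambda>t. of_real (jacobi_off j) * E (Suc j) t) f"
    unfolding weak_sol_def using fH F by (auto intro: A_domI)
  then have 1: "L2_inner M f (E (Suc j)) = of_real (jacobi_off j) * green (Suc j) z"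
    by (rule weak_sol_scaled_E[OF _ j(3) assms(2)])
  \<comment> \<open>The identity comes from evaluating (tf, e_j) twice: moving t onto e_j gives b_j
    (f, e_(j+1)), while inserting f = e_j - g / m gives a_j - z - 1/m.\<close>
  have "L2_inner M (mult_op f) (E j) = of_real (jacobi_off j) * L2_inner M f (E (Suc j))"
    using L2_inner_mult_op_cnj[of M f "E j"] L2_inner_H_sub_mult_op_E[OF fH assms(1)]
      L2_inner_cnj[of M f "E (Suc j)"] by simp
  moreover have "L2_inner M (mult_op g) (E j) = z * m + 1"
    using weak_solD(2)[OF g(1) E_in_H_sub[OF j(1)]] j(1) by (simp add: L2_inner_E m_def g(2))
  then have "L2_inner M (mult_op f) (E j) = of_real (jacobi_diag j) - z - 1 / m"
    using mfip[OF E2] m0 by (simp add: L2_inner_mult_op_E_E field_simps)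
  ultimately show ?thesis
    unfolding 1 m_def[symmetric] by (simp add: power2_eq_square mult.assoc)
qed

text \<open>The vector e_j + z g solves the equation with right-hand side t e_j, and pairing it with
  t e_j produces exactly the quantity to be bounded. The step needs e_j in the domain, hence j <
  p.\<close>

lemma green_remainder_bound:
  assumes "j < p" "z \<notin> \<real>"
  shows "cmod (z\<^sup>2 * green j z + z + of_real (jacobi_diag j)) \<le> (L2_norm M (mult_op (E j)))\<^sup>2 / \<bar>Im z\<bar>"
proof -
  have j: "j \<le> p" "j \<le> p + 1" using assms by auto
  obtain g where g: "weak_sol j z (E j) g" "green j z = L2_inner M g (E j)"
    by (rule green_witness[OF j(1) assms(2)])
  note G = A_dom_D[OF weak_solD(1)[OF g(1)]] and E2 = E_L2[OF j(1)] and tE = mult_op_E_L2[OF assms(1)]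
  define f where "f = (\<lambda>t. E j t + z * g t)"
  have fA: "f \<in> A_dom M j"
    unfolding f_def by (rule A_dom_add_scale[OF E_in_A_dom[OF assms(1)] weak_solD(1)[OF g(1)] j(2)])
  have fip: "L2_inner M f h = L2_inner M (E j) h + z * L2_inner M g h" if "h \<in> L2 M" for h
    unfolding f_def using E2 G that by (simp add: L2_inner_add L2_scale L2_inner_scale)
  have "mult_op f = (\<lambda>t. mult_op (E j) t + z * mult_op g t)"
    by (simp add: f_def mult_op_def algebra_simps)
  then have mfip: "L2_inner M (mult_op f) h = L2_inner M (mult_op (E j)) h + z * L2_inner M (mult_op g) h"
    if "h \<in> L2 M" for h
    using tE G that by (simp add: L2_inner_add L2_scale L2_inner_scale)
  have "weak_sol j z (mult_op (E j)) f"
    unfolding weak_sol_def using fA mfip fip weak_solD(2)[OF g(1)] H_sub_L2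
    by (auto simp: algebra_simps)
  moreover have "L2_inner M f (mult_op (E j)) = z\<^sup>2 * green j z + z + of_real (jacobi_diag j)"
  proof -
    have "L2_inner M g (mult_op (E j)) = z * green j z + 1"
      using weak_solD(2)[OF g(1) E_in_H_sub[OF j(1)]] j(1) L2_inner_mult_op[of M g "E j"]
      by (simp add: L2_inner_E g(2))
    moreover have "L2_inner M (E j) (mult_op (E j)) = of_real (jacobi_diag j)"
      using L2_inner_mult_op_E_E[of j] L2_inner_mult_op[of M "E j" "E j"] by simp
    ultimately show ?thesis
      using fip[OF tE] by (simp add: power2_eq_square algebra_simps)
  qed
  ultimately show ?thesis
    using weak_sol_inner_bound[OF _ tE assms(2)] by metis
qed

text \<open>At order 1 only i = 0 and i = 1 occur, and there c a_j^i is a compact name for c and c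
  a_j. The factor c makes room for ||u_j||^2.\<close>

lemma green_expansion:
  assumes "j < p"
  shows "nev_expansion (\<lambda>z. of_real c * green j z) (\<lambda>i. c * jacobi_diag j ^ i) 1"
proof (rule nev_expansionI)
  let ?z = "\<lambda>y::real. \<i> * of_real y :: complex"
  let ?a = "complex_of_real (jacobi_diag j)"
  let ?C = "(L2_norm M (mult_op (E j)))\<^sup>2"
  have ev: "eventually (\<lambda>y::real. y \<noteq> 0) at_infinity"
    by (auto simp: eventually_at_infinity intro!: exI[of _ 1])
  have "((\<lambda>y. (?z y)\<^sup>2 * green j (?z y) + ?z y + ?a) \<longlongrightarrow> 0) at_infinity"
  proof (rule Lim_null_comparison)
    show "eventually (\<lambda>y. cmod ((?z y)\<^sup>2 * green j (?z y) + ?z y + ?a) \<le> ?C * \<bar>inverse y\<bar>) at_infinity"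
      using ev
    proof eventually_elim
      case (elim y)
      then have "?z y \<notin> \<real>" by (simp add: complex_is_Real_iff)
      from green_remainder_bound[OF assms this] show ?case
        by (simp add: divide_inverse)
    qed
    have "((\<lambda>y::real. ?C * \<bar>inverse y\<bar>) \<longlongrightarrow> ?C * \<bar>0\<bar>) at_infinity"
      by (intro tendsto_intros tendsto_inverse_0)
    then show "((\<lambda>y::real. ?C * \<bar>inverse y\<bar>) \<longlongrightarrow> 0) at_infinity" by simp
  qed
  from tendsto_mult[OF tendsto_const[of "of_real c"] this]
  have "((\<lambda>y. of_real c * ((?z y)\<^sup>2 * green j (?z y) + ?z y + ?a)) \<longlongrightarrow> 0) at_infinity" by simp
  moreover have "eventually (\<lambda>y. of_real c * ((?z y)\<^sup>2 * green j (?z y) + ?z y + ?a)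
      = (of_real c * green j (?z y) + (\<Sum>i\<le>1. of_real (c * jacobi_diag j ^ i) / ?z y ^ (i + 1))) * ?z y ^ (1 + 1)) at_infinity"
    using ev by eventually_elim (simp add: field_simps power2_eq_square)
  ultimately show "((\<lambda>y. (of_real c * green j (?z y) + (\<Sum>i\<le>1. of_real (c * jacobi_diag j ^ i) / ?z y ^ (i + 1))) * ?z y ^ (1 + 1)) \<longlongrightarrow> 0) at_infinity"
    using tendsto_cong by fast
qed

section \<open>Norms and directions of the vectors u_j\<close>

text \<open>The anticipated value of ||u_j||, fixed before \<open>u_seq\<close> is analysed. For j =
  0 it is ||u||, as e_0 is the constant 1/||u||.\<close>

definition u_norm :: "nat \<Rightarrow> real" where
  "u_norm j = (case j of 0 \<Rightarrow> 1 / Polynomial.coeff (e 0) 0 | Suc i \<Rightarrow> jacobi_off i)"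

lemma u_norm_pos: "j \<le> p \<Longrightarrow> 0 < u_norm j"
  using lead_coeff_e_pos[of 0] by (auto simp: u_norm_def jacobi_off_pos split: nat.split)

text \<open>Telescoping, since each b_i is a ratio of leading coefficients. This evaluates the
  denominator in the definition of u_(j+1).\<close>

lemma prod_u_norm: "j \<le> p \<Longrightarrow> (\<Prod>i\<in>{..j}. u_norm i) = 1 / Polynomial.coeff (e j) j"
proof (induction j)
  case 0
  then show ?case by (simp add: u_norm_def)
next
  case (Suc j)
  then have "Polynomial.coeff (e j) j = jacobi_off j * Polynomial.coeff (e (Suc j)) (Suc j)"
    and "0 < jacobi_off j"
    using lead_coeff_e_Suc[of j] jacobi_off_pos[of j] by auto
  with Suc show ?case by (simp add: u_norm_def)
qed

lemma u_gen_eq: "u_gen = (\<lambda>t. of_real (u_norm 0) * E 0 t)"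
proof
  fix t
  obtain c where c: "e 0 = [:c:]" using degree_e[of 0] by (auto elim: degree_eq_zeroE)
  have "c \<noteq> 0" using lead_coeff_e_pos[of 0] c by simp
  then show "u_gen t = of_real (u_norm 0) * E 0 t"
    by (simp add: u_gen_def u_norm_def c cpoly_def flip: of_real_mult)
qed

lemma L2_norm_scaled_E:
  assumes "j \<le> p"
  shows "L2_norm M (\<lambda>t. of_real (u_norm j) * E j t) = u_norm j"
proof -
  have "(of_real ((L2_norm M (E j))\<^sup>2) :: complex) = 1"
    using L2_inner_E[OF assms assms] by (simp add: L2_inner_self)
  then have "(L2_norm M (E j))\<^sup>2 = 1" by (simp only: of_real_eq_1_iff)
  then have "L2_norm M (E j) = 1"
    using L2_norm_nonneg[of M "E j"] power2_eq_1_iff by force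
  then show ?thesis
    using u_norm_pos[OF assms] by (simp add: L2_norm_scale)
qed

text \<open>Dividing e_j by its leading coefficient makes it differ from t^j by a polynomial of
  degree below j, which H_j does not see.\<close>

lemma L2_proj_monom_AE:
  assumes "j \<le> p"
  shows "AE t in M. L2_proj M (H_sub M j) ((mult_op ^^ j) u_gen) t = of_real (1 / Polynomial.coeff (e j) j) * E j t"
proof (rule L2_proj_AE)
  let ?c = "1 / Polynomial.coeff (e j) j"
  let ?x = "Polynomial.monom 1 j :: real poly"
  note c = lead_coeff_e_pos[OF assms]
  have x2: "cpoly ?x \<in> L2 M" using assms by (intro cpoly_L2) (simp add: degree_monom_eq)
  show "(mult_op ^^ j) u_gen \<in> L2 M" unfolding mult_op_power_u_gen by (rule x2)
  show "(\<lambda>t. of_real ?c * E j t) \<in> H_sub M j"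
    by (intro H_sub_scale E_in_H_sub assms)
  fix h assume h: "h \<in> H_sub M j"
  have "Polynomial.coeff (?x - Polynomial.smult ?c (e j)) n = 0" if "n \<ge> j" for n
    using that c coeff_e_eq_0[OF assms, of n] by (cases "n = j") auto
  then have "L2_inner M h (cpoly (?x - Polynomial.smult ?c (e j))) = 0"
    using assms by (intro H_sub_orthogonal[OF h]) auto
  moreover have "cpoly (?x - Polynomial.smult ?c (e j)) = (\<lambda>t. cpoly ?x t - of_real ?c * E j t)"
    by (simp add: cpoly_def)
  ultimately have "L2_inner M h (cpoly ?x) = L2_inner M h (\<lambda>t. of_real ?c * E j t)"
    using x2 L2_scale[OF E_L2[OF assms]] H_sub_L2[OF h] by (simp only: L2_inner_diff_right) simp
  then show "L2_inner M ((mult_op ^^ j) u_gen) h = L2_inner M (\<lambda>t. of_real ?c * E j t) h"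
    unfolding mult_op_power_u_gen by (metis L2_inner_cnj)
qed (use assms in simp)

text \<open>The denominator of u_j involves the norms of all earlier u_l, so direction and norm have
  to be carried together through a strong induction.\<close>

lemma u_seq_props:
  "j \<le> p \<Longrightarrow> u_seq M j \<in> H_sub M j \<and> (AE t in M. u_seq M j t = of_real (u_norm j) * E j t)
     \<and> L2_norm M (u_seq M j) = u_norm j"
proof (induction j rule: less_induct)
  case (less j)
  have norm: "L2_norm M (u_seq M j) = u_norm j"
    if "u_seq M j \<in> H_sub M j" "AE t in M. u_seq M j t = of_real (u_norm j) * E j t"
    using L2_norm_cong_AE[OF L2_D(1)[OF H_sub_L2[OF that(1)]] L2_D(1)[OF L2_scale[OF E_L2[OF less.prems]]] that(2)]
      L2_norm_scaled_E[OF less.prems] by simp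
  show ?case
  proof (cases j)
    case 0
    have "u_gen \<in> H_sub M 0"
      unfolding u_gen_eq by (intro H_sub_scale E_in_H_sub) simp
    moreover have "AE t in M. u_gen t = of_real (u_norm 0) * E 0 t"
      by (subst u_gen_eq) simp
    ultimately show ?thesis using norm 0 by simp
  next
    case (Suc i)
    have "(\<Prod>l\<in>{..i}. L2_norm M (u_seq M l)) = (\<Prod>l\<in>{..i}. u_norm l)"
      using less Suc by (intro prod.cong) auto
    then have u: "u_seq M j = (\<lambda>t. of_real (Polynomial.coeff (e i) i) * L2_proj M (H_sub M j) ((mult_op ^^ j) u_gen) t)"
      using prod_u_norm[of i] less.prems Suc by (simp add: mult.commute)
    have "(mult_op ^^ j) u_gen \<in> L2 M"
      unfolding mult_op_power_u_gen using less.prems by (intro cpoly_L2) (simp add: degree_monom_eq)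
    then have H: "u_seq M j \<in> H_sub M j"
      unfolding u using less.prems by (intro H_sub_scale L2_proj_H_sub) auto
    \<comment> \<open>The denominator contributes the leading coefficient of e_i, the projection the
      reciprocal of that of e_j; with j = i + 1 their product is b_i.\<close>
    have "u_norm j = Polynomial.coeff (e i) i * (1 / Polynomial.coeff (e j) j)"
      using lead_coeff_e_Suc[of i] lead_coeff_e_pos[of j] less.prems Suc by (simp add: u_norm_def)
    then have "AE t in M. u_seq M j t = of_real (u_norm j) * E j t"
      using L2_proj_monom_AE[OF less.prems] unfolding u
      by (auto elim!: eventually_mono)
    then show ?thesis using norm H by simp
  qed
qed

section \<open>From n to its iterated Schur transforms\<close>

lemma green_0:
  assumes "z \<notin> \<real>"
  shows "of_real ((u_norm 0)\<^sup>2) * green 0 z = (LINT t|M. 1 / (of_real t - z))"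
proof -
  have u2: "u_gen \<in> L2 M" using u_seq_props[of 0] H_sub_L2[of u_gen 0] by simp
  let ?f = "\<lambda>t. u_gen t / (of_real t - z)"
  have "weak_sol 0 z (\<lambda>t. of_real (u_norm 0) * E 0 t) ?f"
    using weak_sol_0[OF u2 assms] by (subst (asm) (1) u_gen_eq)
  then have "L2_inner M ?f (E 0) = of_real (u_norm 0) * green 0 z"
    by (rule weak_sol_scaled_E) (use assms in auto)
  then have "of_real ((u_norm 0)\<^sup>2) * green 0 z = L2_inner M ?f (\<lambda>t. of_real (u_norm 0) * E 0 t)"
    by (simp add: L2_inner_scale_right power2_eq_square)
  also have "\<dots> = L2_inner M ?f u_gen" by (simp only: u_gen_eq[symmetric])
  finally show ?thesis by (simp add: L2_inner_def u_gen_def)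
qed

text \<open>u_j equals its multiple of e_j only almost everywhere, so the resolvent equation and the
  final inner product are each transferred to that multiple, where \<open>weak_sol_scaled_E\<close>
  applies.\<close>

lemma operator_representation_A:
  assumes "j \<le> p" and m: "\<And>z. z \<notin> \<real> \<Longrightarrow> m z = of_real ((u_norm j)\<^sup>2) * green j z"
  shows "operator_representation M m (H_sub M j) (A_dom M j) (A_op M j) (u_seq M j)"
  unfolding operator_representation_def
proof (intro conjI allI impI)
  note u = u_seq_props[OF assms(1)]
  let ?u = "\<lambda>t. of_real (u_norm j) * E j t"
  show "self_adjoint_in M (H_sub M j) (A_dom M j) (A_op M j)" by (rule self_adjoint_A[OF assms(1)])
  show "u_seq M j \<in> H_sub M j" using u by simp
  fix z :: complex assume z: "z \<notin> \<real>"
  show "in_resolvent_set M (H_sub M j) (A_dom M j) (A_op M j) z" by (rule in_resolvent_set_A[OF assms(1) z])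
  let ?f = "resolvent M (A_dom M j) (A_op M j) z (u_seq M j)"
  have s: "weak_sol j z (u_seq M j) ?f"
    using weak_sol_resolvent[OF assms(1) z] u by blast
  note f = A_dom_D(1)[OF weak_solD(1)[OF s]]
  have u2: "u_seq M j \<in> L2 M" "?u \<in> L2 M"
    using u H_sub_L2 L2_scale[OF E_L2[OF assms(1)]] by auto
  have "weak_sol j z ?u ?f"
    using weak_sol_cong_AE[OF s u2] u by simp
  from weak_sol_scaled_E[OF this assms(1) z]
  have "L2_inner M ?f ?u = of_real ((u_norm j)\<^sup>2) * green j z"
    by (simp add: L2_inner_scale_right power2_eq_square)
  moreover have "L2_inner M ?f (u_seq M j) = L2_inner M ?f ?u"
    using L2_inner_cong_AE[OF u2 f] u L2_inner_cnj[of M ?f] by metis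
  ultimately show "m z = L2_inner M ?f (u_seq M j)" using m[OF z] by simp
qed

text \<open>The closed form reaches j = p, but a further transform is asserted only for j < p, where
  the expansion of m_j is available.\<close>

lemma iterated_schur_transform:
  assumes "n \<in> nevanlinna" and "\<And>z. z \<notin> \<real> \<Longrightarrow> n z = (LINT t|M. 1 / (of_real t - z))"
  shows "j \<le> p \<Longrightarrow> (schur_transform ^^ j) n \<in> nevanlinna
     \<and> (\<forall>z. z \<notin> \<real> \<longrightarrow> (schur_transform ^^ j) n z = of_real ((u_norm j)\<^sup>2) * green j z)"
    and "j < p \<Longrightarrow> has_schur_transform ((schur_transform ^^ j) n)"
proof -
  let ?n = "\<lambda>j. (schur_transform ^^ j) n"
  have exp: "nev_expansion (?n j) (\<lambda>i. (u_norm j)\<^sup>2 * jacobi_diag j ^ i) 1"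
    if "j < p" "\<forall>z. z \<notin> \<real> \<longrightarrow> ?n j z = of_real ((u_norm j)\<^sup>2) * green j z" for j
    using that nev_expansion_cong[OF _ green_expansion[OF that(1)]] by simp
  have main: "?n j \<in> nevanlinna \<and> (\<forall>z. z \<notin> \<real> \<longrightarrow> ?n j z = of_real ((u_norm j)\<^sup>2) * green j z)"
    if "j \<le> p" for j
    using that
  proof (induction j)
    case 0
    then show ?case using assms green_0 by simp
  next
    case (Suc j)
    then have j: "j < p" "j \<le> p" and N: "?n j \<in> nevanlinna"
      and G: "\<And>z. z \<notin> \<real> \<Longrightarrow> ?n j z = of_real ((u_norm j)\<^sup>2) * green j z" by auto
    have w: "u_norm j \<noteq> 0" using u_norm_pos[OF j(2)] by simp
    \<comment> \<open>With tau_0 = ||u_j||^2 and tau_1 = ||u_j||^2 a_j the quotient is a_j. The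
      formula holds for every z, so analyticity can be read off from it; the scale cancels in the
      next step, which leaves \<open>green_Suc\<close>.\<close>
    have S: "?n (Suc j) z = - of_real ((u_norm j)\<^sup>2) / ?n j z - z + of_real (jacobi_diag j)" for z
      using schur_transform_eq[OF exp[OF j(1)], of z] G w by simp
    have val: "?n (Suc j) z = of_real ((u_norm (Suc j))\<^sup>2) * green (Suc j) z" if "z \<notin> \<real>" for z
      using w green_nonzero[OF j(2) that] green_Suc[OF j(1) that] unfolding S G[OF that]
      by (simp add: u_norm_def)
    have "?n (Suc j) analytic_on {z. Im z > 0}"
    proof -
      have "(\<lambda>z. - of_real ((u_norm j)\<^sup>2) / ?n j z - z + of_real (jacobi_diag j)) analytic_on {z. Im z > 0}"
      proof (intro analytic_intros)
        show "?n j analytic_on {z. Im z > 0}" using N by (simp add: nevanlinna_def)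
        fix z assume "z \<in> {z. Im z > 0}"
        then have "z \<notin> \<real>" by (auto simp: complex_is_Real_iff)
        then show "?n j z \<noteq> 0" using G green_nonzero[OF j(2)] w by simp
      qed
      then show ?thesis unfolding S[symmetric] .
    qed
    moreover have "Im (?n (Suc j) z) \<ge> 0" if "Im z > 0" for z
    proof -
      have "z \<notin> \<real>" using that by (auto simp: complex_is_Real_iff)
      moreover have "0 < Im (green (Suc j) z)"
        using green_Im_pos[OF _ that] Suc.prems by blast
      ultimately show ?thesis using val by simp
    qed
    moreover have "?n (Suc j) z = cnj (?n (Suc j) (cnj z))" if "Im z < 0" for z
    proof -
      have "z \<notin> \<real>" "cnj z \<notin> \<real>" using that by (auto simp: complex_is_Real_iff)
      then show ?thesis using val green_cnj[OF Suc.prems] by simp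
    qed
    ultimately have "?n (Suc j) \<in> nevanlinna"
      unfolding nevanlinna_def by blast
    then show ?case using val by blast
  qed
  show "?n j \<in> nevanlinna \<and> (\<forall>z. z \<notin> \<real> \<longrightarrow> ?n j z = of_real ((u_norm j)\<^sup>2) * green j z)"
    if "j \<le> p" using main[OF that] .
  show "has_schur_transform (?n j)" if "j < p"
  proof -
    have N: "?n j \<in> nevanlinna" "\<forall>z. z \<notin> \<real> \<longrightarrow> ?n j z = of_real ((u_norm j)\<^sup>2) * green j z"
      using main[of j] that by auto
    have i: "\<i> \<notin> \<real>" by (simp add: complex_is_Real_iff)
    have "?n j \<i> \<noteq> 0"
      using N(2) that i green_nonzero[of j \<i>] u_norm_pos[of j] by simp
    then show ?thesis
      unfolding has_schur_transform_def using N(1) exp[OF that N(2)] i by blast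
  qed
qed

end

theorem mainTheorem5:
  fixes p :: nat and n :: "complex \<Rightarrow> complex" and s :: "nat \<Rightarrow> real" and \<sigma> :: "real measure"
  assumes "p \<ge> 1"
    and "n \<in> nevanlinna"
    and "nev_expansion n s (2 * p)"
    and "Determinant.det (Matrix.mat (p + 1) (p + 1) (\<lambda>(i, l). s (i + l))) \<noteq> 0"
    and "finite_measure \<sigma>" and "sets \<sigma> = sets borel"
    and "\<And>z. z \<notin> \<real> \<Longrightarrow> n z = (LINT t|\<sigma>. 1 / (of_real t - z))"
  shows "(\<forall>j\<in>{1..p}. has_schur_transform ((schur_transform ^^ (j - 1)) n)
            \<and> operator_representation \<sigma> ((schur_transform ^^ j) n)
                (H_sub \<sigma> j) (A_dom \<sigma> j) (A_op \<sigma> j) (u_seq \<sigma> j))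
    \<and> L2_norm \<sigma> u_gen = sqrt (s 0)
    \<and> (\<exists>a b. (\<forall>k<p. three_term_recurrence (orthonormal_poly \<sigma>) a b k \<and> b k > 0)
            \<and> (\<forall>j\<in>{1..p}. L2_norm \<sigma> (u_seq \<sigma> j) = b (j - 1)))"
proof -
  note mom = moments_of_expansion[OF assms(5,6,7,3)]
  interpret finite_measure \<sigma> by fact
  \<comment> \<open>The determinant condition enters here, as definiteness on polynomials of degree
    at most p.\<close>
  interpret moment_measure \<sigma> p
    by unfold_locales (use assms(6) mom(1) hankel_definite[OF mom assms(4)] in auto)
  have rep: "\<forall>j\<in>{1..p}. has_schur_transform ((schur_transform ^^ (j - 1)) n)
      \<and> operator_representation \<sigma> ((schur_transform ^^ j) n)
          (H_sub \<sigma> j) (A_dom \<sigma> j) (A_op \<sigma> j) (u_seq \<sigma> j)"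
  proof (intro ballI conjI)
    fix j assume j: "j \<in> {1..p}"
    then show "has_schur_transform ((schur_transform ^^ (j - 1)) n)"
      by (intro iterated_schur_transform(2)[OF assms(2,7)]) auto
    show "operator_representation \<sigma> ((schur_transform ^^ j) n)
        (H_sub \<sigma> j) (A_dom \<sigma> j) (A_op \<sigma> j) (u_seq \<sigma> j)"
      using j iterated_schur_transform(1)[OF assms(2,7), of j] by (intro operator_representation_A) auto
  qed
  have norm0: "L2_norm \<sigma> u_gen = sqrt (s 0)"
    using mom(2)[of 0] by (simp add: L2_norm_def u_gen_def)
  have rec: "\<forall>k<p. three_term_recurrence (orthonormal_poly \<sigma>) jacobi_diag jacobi_off k \<and> jacobi_off k > 0"
    using three_term_recurrence_e jacobi_off_pos by blast
  have norms: "\<forall>j\<in>{1..p}. L2_norm \<sigma> (u_seq \<sigma> j) = jacobi_off (j - 1)"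
  proof
    fix j assume "j \<in> {1..p}"
    then show "L2_norm \<sigma> (u_seq \<sigma> j) = jacobi_off (j - 1)"
      using u_seq_props[of j] by (cases j) (auto simp: u_norm_def)
  qed
  show ?thesis
    by (rule conjI[OF rep conjI[OF norm0]], rule exI[of _ jacobi_diag], rule exI[of _ jacobi_off])
       (rule conjI[OF rec norms])
qed

end
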